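(* Let $\mathcal{M}_i$ ($i\in\mathbb{N}$) and $\mathcal{M}$ be compact convex bodies in $\mathbb{R}^n$ with $\mathcal{M}_i\to\mathcal{M}$ in the Hausdorff metric. Then the functionals $\mathcal{F}(\cdot,\mathcal{M}_i)$ $\Gamma$-converge to $\mathcal{F}(\cdot,\mathcal{M})$ with respect to weak-$L^1$ convergence. Furthermore, the functionals $\mathcal{F}(\cdot,\mathcal{M}_i)$ are equicoercive with respect to the weak-$L^1$ topology.
   Context: For a compact convex body $\mathcal{M}\subset\mathbb{R}^n$, $Ex(\cdot,\mathcal{M}):\mathrm{SO}(n)\to\mathbb{R}$ is $Ex(R,\mathcal{M})=|\mathcal{M}-R\mathcal{M}|$, where $A-B=\{a-b:a\in A,b\in B\}$ and $|\cdot|$ is Lebesgue measure. Fix $\rho_0>0$ and let $X=\{\rho\in L^1(\mathrm{SO}(n)):\rho\ge0\text{ a.e.},\ \int_{\mathrm{SO}(n)}\rho(R)\,dR=\rho_0\}$ (with $dR$ Haar measure), equipped with weak-$L^1$ convergence. The Onsager free energy $\mathcal{F}(\cdot,\mathcal{M}):X\to\mathbb{R}\cup\{+\infty\}$ is $$\mathcal{F}(\rho,\mathcal{M})=\int_{\mathrm{SO}(n)}\rho(R)\ln\rho(R)\,dR+\frac12\int_{\mathrm{SO}(n)}\int_{\mathrm{SO}(n)}\rho(R)\rho(S)\,Ex(RS^T,\mathcal{M})\,dR\,dS .$$ $\Gamma$-convergence of $F_i$ to $F$ on $X$ means: (1) for every $x\in X$ and every sequence $x_i\to x$, $\liminf_{i\to\infty}F_i(x_i)\ge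 F(x)$; (2) for every $x\in X$ there is a sequence $x_i\to x$ with $\limsup_{i\to\infty}F_i(x_i)=F(x)$. Equicoercivity of $(F_i)$ means: if $x_i\in X$ and $F_i(x_i)$ is uniformly bounded, then a subsequence $x_{i_j}$ converges to some $x\in X$. *)

theory Defs
  imports "HOL-Analysis.Analysis"
begin

section \<open>Convex bodies and the Hausdorff metric\<close>

definition convex_body :: "'a::euclidean_space set \<Rightarrow> bool" where
  "convex_body M \<longleftrightarrow> compact M \<and> convex M \<and> interior M \<noteq> {}"

text \<open>Only used for nonempty bounded sets, where both suprema are finite.\<close>

definition hausdorff_distance :: "'a::metric_space set \<Rightarrow> 'a set \<Rightarrow> real" where
  "hausdorff_distance A B = max (SUP a\<in>A. infdist a B) (SUP b\<in>B. infdist b A)"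

section \<open>The rotation group and its Haar measure\<close>

definition SO :: "(real^'n^'n) set" where
  "SO = {R. rotation_matrix R}"

text \<open>
  A Haar measure on the compact group \<open>SO\<close> is a nonzero finite left-invariant Borel measure
  (regularity is automatic on a compact metric space). It is unique up to a positive factor;
  no normalisation is imposed.
\<close>

definition haar_measure_SO :: "(real^'n^'n) measure \<Rightarrow> bool" where
  "haar_measure_SO \<mu> \<longleftrightarrow>
     space \<mu> = SO \<and>
     sets \<mu> = sets (restrict_space borel SO) \<and>
     finite_measure \<mu> \<and>
     emeasure \<mu> SO \<noteq> 0 \<and>
     (\<forall>Q\<in>SO. \<forall>A\<in>sets \<mu>. emeasure \<mu> ((\<lambda>R. Q ** R) ` A) = emeasure \<mu> A)"

section \<open>The Onsager free energy\<close>

text \<open>\<open>A - B\<close> on sets denotes the complement of \<open>B\<close> in \<open>A\<close>, hence a separate constant.\<close>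

definition minkowski_diff :: "'a::ab_group_add set \<Rightarrow> 'a set \<Rightarrow> 'a set" where
  "minkowski_diff A B = {a - b | a b. a \<in> A \<and> b \<in> B}"

definition Ex_vol :: "real^'n^'n \<Rightarrow> (real^'n) set \<Rightarrow> real" where
  "Ex_vol R M = measure lebesgue (minkowski_diff M ((\<lambda>x. R *v x) ` M))"

text \<open>The Lebesgue integral with values in the extended reals, as the difference of the integrals
  of the positive and the negative part. For \<open>\<rho> ln \<rho>\<close> with \<open>\<rho> \<ge> 0\<close> the negative part is bounded,
  so on a finite measure space the value is never \<open>-\<infinity>\<close>. Note \<open>0 * ln 0 = 0\<close>.\<close>

definition extended_integral :: "'a measure \<Rightarrow> ('a \<Rightarrow> real) \<Rightarrow> ereal" where
  "extended_integral \<mu> f =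
     enn2ereal (\<integral>\<^sup>+ x. ennreal (f x) \<partial>\<mu>) - enn2ereal (\<integral>\<^sup>+ x. ennreal (- f x) \<partial>\<mu>)"

text \<open>The interaction term is a real integral: \<open>Ex_vol\<close> is bounded on \<open>SO\<close> for bounded \<open>M\<close>.\<close>

definition onsager_energy ::
  "(real^'n^'n) measure \<Rightarrow> (real^'n) set \<Rightarrow> (real^'n^'n \<Rightarrow> real) \<Rightarrow> ereal" where
  "onsager_energy \<mu> M \<rho> =
     extended_integral \<mu> (\<lambda>R. \<rho> R * ln (\<rho> R)) +
     ereal (1/2 * (\<integral>R. (\<integral>S. \<rho> R * \<rho> S * Ex_vol (R ** transpose S) M \<partial>\<mu>) \<partial>\<mu>))"

section \<open>Densities and weak convergence in $L^1$\<close>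

text \<open>Elements of \<open>L\<^sup>1\<close> are handled through representatives; the energy and the notion of convergence
  below are invariant under changes on null sets.\<close>

definition densities :: "'a measure \<Rightarrow> real \<Rightarrow> ('a \<Rightarrow> real) set" where
  "densities \<mu> \<rho>\<^sub>0 = {\<rho>. integrable \<mu> \<rho> \<and> (AE x in \<mu>. \<rho> x \<ge> 0) \<and> (\<integral>x. \<rho> x \<partial>\<mu>) = \<rho>\<^sub>0}"

text \<open>Weak convergence, tested against \<open>L\<^sup>\<infinity>\<close>, the dual of \<open>L\<^sup>1\<close>.\<close>

definition weak_L1_conv :: "'a measure \<Rightarrow> (nat \<Rightarrow> 'a \<Rightarrow> real) \<Rightarrow> ('a \<Rightarrow> real) \<Rightarrow> bool" where
  "weak_L1_conv \<mu> f g \<longleftrightarrow>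
     (\<forall>h \<in> borel_measurable \<mu>. (\<exists>C. AE x in \<mu>. \<bar>h x\<bar> \<le> C) \<longrightarrow>
        (\<lambda>i. \<integral>x. f i x * h x \<partial>\<mu>) \<longlonglongrightarrow> (\<integral>x. g x * h x \<partial>\<mu>))"

section \<open>Gamma-convergence and equicoercivity\<close>

text \<open>Both notions are taken with respect to a notion \<open>conv\<close> of convergence of sequences.\<close>

definition gamma_converges ::
  "'x set \<Rightarrow> ((nat \<Rightarrow> 'x) \<Rightarrow> 'x \<Rightarrow> bool) \<Rightarrow> (nat \<Rightarrow> 'x \<Rightarrow> ereal) \<Rightarrow> ('x \<Rightarrow> ereal) \<Rightarrow> bool" where
  "gamma_converges X conv F G \<longleftrightarrow>
     (\<forall>x\<in>X. \<forall>y. (\<forall>i. y i \<in> X) \<and> conv y x \<longrightarrow> liminf (\<lambda>i. F i (y i)) \<ge> G x) \<and>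
     (\<forall>x\<in>X. \<exists>y. (\<forall>i. y i \<in> X) \<and> conv y x \<and> limsup (\<lambda>i. F i (y i)) = G x)"

definition equicoercive ::
  "'x set \<Rightarrow> ((nat \<Rightarrow> 'x) \<Rightarrow> 'x \<Rightarrow> bool) \<Rightarrow> (nat \<Rightarrow> 'x \<Rightarrow> ereal) \<Rightarrow> bool" where
  "equicoercive X conv F \<longleftrightarrow>
     (\<forall>y. (\<forall>i. y i \<in> X) \<and> (\<exists>C::real. \<forall>i. \<bar>F i (y i)\<bar> \<le> ereal C) \<longrightarrow>
        (\<exists>r. strict_mono r \<and> (\<exists>x\<in>X. conv (\<lambda>j. y (r j)) x)))"

end

theory Submission
  imports Defs "HOL-Complex_Analysis.Great_Picard"
begin

text \<open>
  If two convex bodies are within Hausdorff distance \<open>\<delta>\<close> and one contains a ball of radius \<open>r\<close>,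
  then each is contained in a dilate of the other by the factor \<open>1 + \<delta>/r\<close> or \<open>(1 - \<delta>/r)\<^sup>-\<^sup>1\<close>,
  the latter by a cancellation law for Minkowski sums. Hence the excluded volume is continuous in the
  rotation and converges uniformly on \<open>SO\<close> along \<open>Ms\<close>. Since \<open>SO\<close> is compact, the interaction term then
  passes to the limit under weak convergence, so everything reduces to the entropy. Young's
  inequality \<open>t ln t \<ge> t h - exp (h - 1)\<close> writes the entropy as a supremum of weakly continuous
  functionals, hence it is lower semicontinuous; constant sequences are recovery sequences.
  A bound on the entropy makes the densities uniformly integrable, and
  uniform integrability yields weak sequential compactness (Dunford-Pettis): along a diagonal subsequence the
  integrals over a countable generating \<open>\<inter>\<close>-stable system converge, by Dynkin's theorem so do
  those over all measurable sets, and the limit set function has a Radon-Nikodym density.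
\<close>

section \<open>Volumes of nearby convex bodies\<close>

text \<open>A hyperplane with normal \<open>w\<close> strictly separates \<open>z\<close> from
  \<open>L\<close>. Moving \<open>z\<close> by \<delta> against \<open>w\<close> makes the gap in
  direction \<open>w\<close> larger than \<delta> times \<open>norm w\<close>, so no point of
  \<open>L\<close> is within \<delta> of the moved point. The assumption \<open>near\<close> is the
  inclusion of \<open>z + B\<close> in \<open>L + B\<close> for the ball \<open>B\<close> of radius
  \<delta>.\<close>

lemma convex_closed_cancel_cball:
  fixes L :: "'a::euclidean_space set"
  assumes "convex L" "closed L" "0 \<le> \<delta>"
    and near: "\<And>u. norm u \<le> \<delta> \<Longrightarrow> \<exists>y\<in>L. dist (z + u) y \<le> \<delta>"
  shows "z \<in> L"
proof (rule ccontr)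
  assume "z \<notin> L"
  moreover have "L \<noteq> {}"
    using near[of 0] \<open>0 \<le> \<delta>\<close> by auto
  ultimately obtain a b where b: "(a - z) \<bullet> z < b" "\<And>x. x \<in> L \<Longrightarrow> b < (a - z) \<bullet> x"
    using separating_hyperplane_closed_point_inset[of L z] assms(1,2) by metis
  define w where "w = a - z"
  have "w \<noteq> 0"
    using b \<open>L \<noteq> {}\<close> unfolding w_def[symmetric] by force
  define u where "u = - (\<delta> / norm w) *\<^sub>R w"
  have "norm u \<le> \<delta>"
    using \<open>w \<noteq> 0\<close> \<open>0 \<le> \<delta>\<close> by (simp add: u_def)
  then obtain y where y: "y \<in> L" "dist (z + u) y \<le> \<delta>"
    using near by blast
  have "w \<bullet> u = - \<delta> * norm w"
    using \<open>w \<noteq> 0\<close> by (simp add: u_def dot_square_norm power2_eq_square)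
  moreover have "w \<bullet> (y - (z + u)) \<le> norm w * \<delta>"
    using y(2) norm_cauchy_schwarz[of w "y - (z + u)"]
    by (smt (verit) dist_commute dist_norm mult_left_mono norm_ge_zero)
  ultimately have "w \<bullet> y \<le> w \<bullet> z"
    by (simp add: inner_diff_right inner_add_right algebra_simps)
  with b y(1) show False
    unfolding w_def[symmetric] by fastforce
qed

text \<open>With t = \<delta>/r, both bounds come from inclusions between affine images and the
  scaling of volume. \<open>K\<close> shrunk towards \<open>p\<close> by the factor 1 - t lies in
  \<open>L\<close>, by cancellation. Conversely, \<open>L\<close> lies in K + t (K - p), which by
  convexity is the dilate of \<open>K\<close> about \<open>p\<close> by 1 + t.\<close>

lemma measure_near_convex_bounds:
  fixes K L :: "'a::euclidean_space set"
  assumes K: "convex K" "compact K" and L: "convex L" "compact L"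
    and ball: "cball p r \<subseteq> K" and \<delta>: "0 \<le> \<delta>" "\<delta> \<le> r" "0 < r"
    and KL: "\<And>x. x \<in> K \<Longrightarrow> \<exists>y\<in>L. dist x y \<le> \<delta>"
    and LK: "\<And>y. y \<in> L \<Longrightarrow> \<exists>x\<in>K. dist y x \<le> \<delta>"
  shows "(1 - \<delta> / r) ^ DIM('a) * measure lebesgue K \<le> measure lebesgue L"
    and "measure lebesgue L \<le> (1 + \<delta> / r) ^ DIM('a) * measure lebesgue K"
proof -
  define t where "t = \<delta> / r"
  have t: "0 \<le> t" "t \<le> 1"
    using \<delta> by (auto simp: t_def)
  \<comment> \<open>A displacement of norm at most \<delta> is t times one of norm at most r, which
    leads from \<open>p\<close> to a point of \<open>K\<close>. If \<delta> = 0, then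
    \<open>r / \<delta>\<close> is 0 and so is \<open>u\<close>, and both claims persist.\<close>
  have push: "p + (r / \<delta>) *\<^sub>R u \<in> K" "t *\<^sub>R (r / \<delta>) *\<^sub>R u = u" if "norm u \<le> \<delta>" for u
  proof -
    have "norm ((r / \<delta>) *\<^sub>R u) \<le> r"
    proof (cases "\<delta> = 0")
      case False
      then have "r * norm u \<le> r * \<delta>" using that \<delta> by (intro mult_left_mono) auto
      then show ?thesis using False \<delta> by (simp add: field_simps)
    qed (use \<delta> in auto)
    then show "p + (r / \<delta>) *\<^sub>R u \<in> K"
      using ball by (auto simp: dist_norm)
    show "t *\<^sub>R (r / \<delta>) *\<^sub>R u = u"
      using that \<delta> by (cases "\<delta> = 0") (auto simp: t_def)
  qed
  have lm: "K \<in> lmeasurable" "L \<in> lmeasurable"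
    using K L by (auto intro: lmeasurable_compact)
  \<comment> \<open>Convexity puts the whole ball of radius \<delta> = t r around
    \<open>(1 - t) x + t p\<close> into \<open>K\<close>, hence within \<delta> of \<open>L\<close>;
    the cancellation law then removes the ball.\<close>
  have "(\<lambda>x. (1 - t) *\<^sub>R x + t *\<^sub>R p) ` K \<subseteq> L"
  proof safe
    fix x assume x: "x \<in> K"
    show "(1 - t) *\<^sub>R x + t *\<^sub>R p \<in> L"
    proof (rule convex_closed_cancel_cball[of L \<delta>])
      fix u :: 'a assume u: "norm u \<le> \<delta>"
      have "(1 - t) *\<^sub>R x + t *\<^sub>R (p + (r / \<delta>) *\<^sub>R u) \<in> K"
        using K(1) x push(1)[OF u] t unfolding convex_alt by blast
      then have "(1 - t) *\<^sub>R x + t *\<^sub>R p + u \<in> K"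
        using push(2)[OF u] by (simp add: scaleR_add_right add.assoc del: scaleR_scaleR)
      then show "\<exists>y\<in>L. dist ((1 - t) *\<^sub>R x + t *\<^sub>R p + u) y \<le> \<delta>"
        by (rule KL)
    qed (use L \<delta> in \<open>auto simp: compact_imp_closed\<close>)
  qed
  then have "measure lebesgue ((\<lambda>x. (1 - t) *\<^sub>R x + t *\<^sub>R p) ` K) \<le> measure lebesgue L"
    using lm K by (intro measure_mono_fmeasurable) (auto intro!: fmeasurableD lmeasurable_compact compact_continuous_image continuous_intros)
  then show "(1 - \<delta> / r) ^ DIM('a) * measure lebesgue K \<le> measure lebesgue L"
    using t by (simp add: measure_lebesgue_affine t_def)
  have "L \<subseteq> (\<lambda>x. (1 + t) *\<^sub>R x + (- t) *\<^sub>R p) ` K"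
  proof
    fix y assume "y \<in> L"
    then obtain x where x: "x \<in> K" "dist y x \<le> \<delta>" using LK by blast
    have u: "norm (y - x) \<le> \<delta>" using x by (simp add: dist_norm)
    define v where "v = p + (r / \<delta>) *\<^sub>R (y - x)"
    have y: "y = x + t *\<^sub>R v - t *\<^sub>R p"
      using push(2)[OF u] by (simp add: v_def scaleR_add_right del: scaleR_scaleR)
    have "1 - t / (1 + t) = 1 / (1 + t)" "0 \<le> t / (1 + t)" "t / (1 + t) \<le> 1"
      using t by (auto simp: field_simps)
    then have "(1 / (1 + t)) *\<^sub>R x + (t / (1 + t)) *\<^sub>R v \<in> K"
      using K(1) x(1) push(1)[OF u] unfolding convex_alt v_def by metis
    moreover have "y = (1 + t) *\<^sub>R ((1 / (1 + t)) *\<^sub>R x + (t / (1 + t)) *\<^sub>R v) + (- t) *\<^sub>R p"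
      using t by (subst y) (simp add: scaleR_add_right)
    ultimately show "y \<in> (\<lambda>x. (1 + t) *\<^sub>R x + (- t) *\<^sub>R p) ` K"
      by blast
  qed
  then have "measure lebesgue L \<le> measure lebesgue ((\<lambda>x. (1 + t) *\<^sub>R x + (- t) *\<^sub>R p) ` K)"
    using lm K by (intro measure_mono_fmeasurable) (auto intro!: fmeasurableD lmeasurable_compact compact_continuous_image continuous_intros)
  then show "measure lebesgue L \<le> (1 + \<delta> / r) ^ DIM('a) * measure lebesgue K"
    using t by (subst (asm) measure_lebesgue_affine) (simp add: t_def)
qed

section \<open>The rotation group and excluded volumes\<close>

lemma infdist_le_hausdorff_distance:
  assumes "bounded A" "B \<noteq> {}" "a \<in> A"
  shows "infdist a B \<le> hausdorff_distance A B"
proof -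
  obtain b where b: "b \<in> B" using assms by auto
  have "bounded (insert b A)" using assms by simp
  then obtain e where e: "\<And>x. x \<in> insert b A \<Longrightarrow> dist b x \<le> e"
    unfolding bounded_any_center[where a = b] by blast
  \<comment> \<open>A real \<open>SUP\<close> is an upper bound of its family only if the family is
    bounded above; this is where the boundedness of \<open>A\<close> enters.\<close>
  have "bdd_above ((\<lambda>a. infdist a B) ` A)"
  proof (rule bdd_aboveI2)
    fix x assume "x \<in> A"
    then show "infdist x B \<le> e"
      using infdist_le[OF b, of x] e[of x] by (simp add: dist_commute)
  qed
  then have "infdist a B \<le> (SUP a\<in>A. infdist a B)"
    using assms by (intro cSUP_upper)
  then show ?thesis
    by (simp add: hausdorff_distance_def)
qed

lemma hausdorff_distance_commute: "hausdorff_distance A B = hausdorff_distance B A"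
  by (simp add: hausdorff_distance_def max.commute)

lemma compact_near_hausdorff_distance:
  fixes A B :: "'a::heine_borel set"
  assumes "compact A" "compact B" "B \<noteq> {}" "a \<in> A"
  shows "\<exists>b\<in>B. dist a b \<le> hausdorff_distance A B"
proof -
  obtain b where "b \<in> B" "infdist a B = dist a b"
    using infdist_attains_inf assms compact_imp_closed by metis
  then show ?thesis
    using infdist_le_hausdorff_distance[of A B a] assms compact_imp_bounded by force
qed

section \<open>Rotations and their compactness\<close>

lemma rotation_matrix_norm:
  fixes R :: "real^'n^'n"
  assumes "R \<in> SO"
  shows "norm (R *v x) = norm x"
proof -
  have "orthogonal_transformation ((*v) R)"
    using assms by (simp add: SO_def rotation_matrix_def orthogonal_transformation_matrix matrix_vector_mul_linear)
  then show ?thesis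
    by (rule orthogonal_transformation_norm)
qed

lemma SO_mult_transpose: "R \<in> SO \<Longrightarrow> S \<in> SO \<Longrightarrow> R ** transpose S \<in> SO"
  by (simp add: SO_def rotation_matrix_def orthogonal_matrix_mul orthogonal_matrix_transpose det_mul det_transpose)

lemma continuous_on_matrix_mult [continuous_intros]:
  fixes f :: "'a::topological_space \<Rightarrow> real^'n^'m" and g :: "'a \<Rightarrow> real^'k^'n"
  assumes "continuous_on A f" "continuous_on A g"
  shows "continuous_on A (\<lambda>x. f x ** g x)"
  unfolding matrix_matrix_mult_def by (intro continuous_intros assms)

lemma continuous_on_transpose [continuous_intros]:
  fixes f :: "'a::topological_space \<Rightarrow> real^'n^'m"
  assumes "continuous_on A f"
  shows "continuous_on A (\<lambda>x. transpose (f x))"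
  unfolding transpose_def by (intro continuous_intros assms)

text \<open>Columns of a rotation are unit vectors, so all entries are at most 1 in absolute value.
  Closedness holds because the defining conditions are polynomial equations in the entries.\<close>

lemma compact_SO: "compact (SO :: (real^'n^'n) set)"
  unfolding compact_eq_bounded_closed
proof
  have "norm R \<le> CARD('n) * CARD('n)" if "R \<in> SO" for R :: "real^'n^'n"
  proof -
    have "\<bar>R $ i $ j\<bar> \<le> 1" for i j
    proof -
      have "\<bar>R $ i $ j\<bar> = \<bar>(R *v axis j 1) $ i\<bar>"
        by (simp add: matrix_vector_mult_basis column_def)
      also have "\<dots> \<le> norm (R *v axis j 1)"
        by (rule component_le_norm_cart)
      finally show ?thesis
        using that by (simp add: rotation_matrix_norm)
    qed
    then have "norm (R $ i) \<le> CARD('n)" for i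
      using norm_le_l1_cart[of "R $ i"] sum_bounded_above[of UNIV "\<lambda>j. \<bar>R $ i $ j\<bar>" 1]
      by (force intro: order_trans)
    then have "(\<Sum>i\<in>UNIV. norm (R $ i)) \<le> CARD('n) * CARD('n)"
      using sum_bounded_above[of UNIV "\<lambda>i. norm (R $ i)" "real CARD('n)"] by simp
    then show ?thesis
      unfolding norm_vec_def[of R] by (smt (verit) L2_set_le_sum norm_ge_zero)
  qed
  then show "bounded (SO :: (real^'n^'n) set)"
    by (auto intro: boundedI)
  have "SO = {R :: real^'n^'n. transpose R ** R = mat 1} \<inter> {R. det R = 1}"
    by (auto simp: SO_def rotation_matrix_def orthogonal_matrix)
  also have "closed \<dots>"
  proof (intro closed_Int closed_Collect_eq)
    have "continuous_on UNIV (\<lambda>R :: real^'n^'n. R $ i $ j)" for i j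
      by (intro continuous_intros)
    then show "continuous_on UNIV (\<lambda>R :: real^'n^'n. det R)"
      unfolding det_def
      by (intro continuous_on_sum continuous_on_mult continuous_on_prod continuous_on_const)
  qed (intro continuous_on_matrix_mult continuous_on_transpose continuous_on_id continuous_on_const)+
  finally show "closed (SO :: (real^'n^'n) set)" .
qed

section \<open>Excluded volumes as volumes of convex bodies\<close>

lemma minkowski_diff_convex_compact:
  fixes M :: "(real^'n) set"
  assumes "convex_body M"
  shows "convex (minkowski_diff M ((\<lambda>x. R *v x) ` M))" "compact (minkowski_diff M ((\<lambda>x. R *v x) ` M))"
proof -
  have *: "minkowski_diff A B = (\<Union>x\<in>A. \<Union>y\<in>B. {x - y})" "minkowski_diff A B = {x - y |x y. x \<in> A \<and> y \<in> B}"
    for A B :: "(real^'n) set"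
    by (auto simp: minkowski_diff_def)
  show "convex (minkowski_diff M ((\<lambda>x. R *v x) ` M))"
    unfolding *(1) using assms
    by (intro convex_differences convex_linear_image matrix_vector_mul_linear) (auto simp: convex_body_def)
  show "compact (minkowski_diff M ((\<lambda>x. R *v x) ` M))"
    unfolding *(2) using assms
    by (intro compact_differences compact_continuous_image linear_continuous_on matrix_vector_mul_bounded_linear)
       (auto simp: convex_body_def)
qed

text \<open>Fixing the second point to be \<open>c\<close> shows that M - R M contains a ball of the
  same radius \<open>r\<close> for every R, so the volume bounds apply with constants independent of
  the rotation. Both a second body and a second matrix are allowed: \<open>M = N\<close> yields
  continuity in the rotation, and \<open>R = S\<close> yields convergence along a sequence of
  bodies.\<close>

lemma Ex_vol_near_bounds:
  fixes M N :: "(real^'n) set" and R S :: "real^'n^'n"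
  assumes M: "convex_body M" and N: "convex_body N"
    and ball: "cball c r \<subseteq> M" and \<delta>: "0 \<le> \<delta>" "\<delta> \<le> r" "0 < r"
    and MN: "\<And>x y. x \<in> M \<Longrightarrow> y \<in> M \<Longrightarrow> \<exists>x'\<in>N. \<exists>y'\<in>N. dist (x - R *v y) (x' - S *v y') \<le> \<delta>"
    and NM: "\<And>x y. x \<in> N \<Longrightarrow> y \<in> N \<Longrightarrow> \<exists>x'\<in>M. \<exists>y'\<in>M. dist (x - S *v y) (x' - R *v y') \<le> \<delta>"
  shows "(1 - \<delta> / r) ^ CARD('n) * Ex_vol R M \<le> Ex_vol S N"
    and "Ex_vol S N \<le> (1 + \<delta> / r) ^ CARD('n) * Ex_vol R M"
proof -
  let ?K = "minkowski_diff M ((\<lambda>x. R *v x) ` M)" and ?L = "minkowski_diff N ((\<lambda>x. S *v x) ` N)"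
  have ball': "cball (c - R *v c) r \<subseteq> ?K"
  proof
    fix x assume "x \<in> cball (c - R *v c) r"
    then have "x + R *v c \<in> cball c r"
      by (simp add: dist_norm algebra_simps)
    then have "x + R *v c \<in> M" "c \<in> M"
      using ball \<delta> by auto
    moreover have "x = (x + R *v c) - R *v c" by simp
    ultimately show "x \<in> ?K"
      unfolding minkowski_diff_def by blast
  qed
  have mem: "z \<in> minkowski_diff A ((\<lambda>x. Q *v x) ` A) \<longleftrightarrow> (\<exists>x\<in>A. \<exists>y\<in>A. z = x - Q *v y)"
    for z A and Q :: "real^'n^'n"
    by (auto simp: minkowski_diff_def)
  have near1: "\<exists>z'\<in>?L. dist z z' \<le> \<delta>" if z: "z \<in> ?K" for z
  proof -
    obtain x y where "x \<in> M" "y \<in> M" "z = x - R *v y" using z unfolding mem by blast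
    then show ?thesis using MN[of x y] mem[of _ N S] by metis
  qed
  have near2: "\<exists>z'\<in>?K. dist z z' \<le> \<delta>" if z: "z \<in> ?L" for z
  proof -
    obtain x y where "x \<in> N" "y \<in> N" "z = x - S *v y" using z unfolding mem by blast
    then show ?thesis using NM[of x y] mem[of _ M R] by metis
  qed
  show "(1 - \<delta> / r) ^ CARD('n) * Ex_vol R M \<le> Ex_vol S N"
    and "Ex_vol S N \<le> (1 + \<delta> / r) ^ CARD('n) * Ex_vol R M"
    using measure_near_convex_bounds[OF minkowski_diff_convex_compact[OF M] minkowski_diff_convex_compact[OF N] ball' \<delta> near1 near2]
    by (simp_all add: Ex_vol_def)
qed

lemma convex_body_cball:
  assumes "convex_body M"
  obtains c r where "cball c r \<subseteq> M" "0 < r"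
  using assms unfolding convex_body_def by (metis all_not_in_conv mem_interior_cball)

text \<open>If \<open>D\<close> bounds the norms in \<open>M\<close>, replacing R by S moves each
  point x - R y by at most the operator norm of S - R times \<open>D\<close>. This distance tends to
  0, and the two-sided volume bounds squeeze the excluded volume.\<close>

lemma continuous_on_Ex_vol:
  fixes M :: "(real^'n) set"
  assumes M: "convex_body M"
  shows "continuous_on UNIV (\<lambda>R :: real^'n^'n. Ex_vol R M)"
proof -
  obtain c r where c: "cball c r \<subseteq> M" "0 < r"
    using convex_body_cball[OF M] .
  obtain D where D: "0 < D" "\<And>x. x \<in> M \<Longrightarrow> norm x \<le> D"
    using M unfolding convex_body_def by (metis compact_imp_bounded bounded_pos)
  have "((\<lambda>S. Ex_vol S M) \<longlongrightarrow> Ex_vol R M) (at R)" for R :: "real^'n^'n"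
  proof -
    define \<delta> where "\<delta> S = onorm ((*v) (S - R)) * D" for S :: "real^'n^'n"
    have \<delta>0: "0 \<le> \<delta> S" for S
      using D by (auto simp: \<delta>_def intro!: mult_nonneg_nonneg onorm_pos_le matrix_vector_mul_bounded_linear)
    have \<delta>: "(\<delta> \<longlongrightarrow> 0) (at R)"
    proof (rule Lim_null_comparison)
      have "\<delta> S \<le> real CARD('n) * real CARD('n) * norm (S - R) * D" for S
      proof -
        have "\<bar>(S - R) $ i $ j\<bar> \<le> norm (S - R)" for i j
          using component_le_norm_cart Finite_Cartesian_Product.norm_nth_le by (rule order_trans)
        then show ?thesis
          unfolding \<delta>_def using D by (intro mult_right_mono onorm_le_matrix_component) auto
      qed
      then show "\<forall>\<^sub>F S in at R. norm (\<delta> S) \<le> real CARD('n) * real CARD('n) * norm (S - R) * D"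
        using \<delta>0 by simp
      have "((\<lambda>S. real CARD('n) * real CARD('n) * norm (S - R) * D) \<longlongrightarrow> real CARD('n) * real CARD('n) * norm (R - R) * D) (at R)"
        by (intro tendsto_intros)
      then show "((\<lambda>S. real CARD('n) * real CARD('n) * norm (S - R) * D) \<longlongrightarrow> 0) (at R)"
        by simp
    qed
    have near: "dist (x - R *v y) (x - S *v y) \<le> \<delta> S" if "y \<in> M" for x y S
    proof -
      have "dist (x - R *v y) (x - S *v y) = norm ((S - R) *v y)"
        by (simp add: dist_norm matrix_vector_mult_diff_rdistrib)
      also have "\<dots> \<le> onorm ((*v) (S - R)) * norm y"
        by (rule onorm) (rule matrix_vector_mul_bounded_linear)
      also have "\<dots> \<le> \<delta> S"
        unfolding \<delta>_def using D that
        by (intro mult_left_mono onorm_pos_le matrix_vector_mul_bounded_linear)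
      finally show ?thesis .
    qed
    have ev: "\<forall>\<^sub>F S in at R. \<delta> S \<le> r"
      using order_tendstoD(2)[OF \<delta>, of r] c(2) by (auto elim: eventually_mono)
    have *: "(1 - \<delta> S / r) ^ CARD('n) * Ex_vol R M \<le> Ex_vol S M \<and>
             Ex_vol S M \<le> (1 + \<delta> S / r) ^ CARD('n) * Ex_vol R M" if "\<delta> S \<le> r" for S
      using near by (intro conjI Ex_vol_near_bounds[OF M M c(1) \<delta>0 that c(2)]) (metis dist_commute)+
    show ?thesis
    proof (rule tendsto_sandwich)
      show "\<forall>\<^sub>F S in at R. (1 - \<delta> S / r) ^ CARD('n) * Ex_vol R M \<le> Ex_vol S M"
        "\<forall>\<^sub>F S in at R. Ex_vol S M \<le> (1 + \<delta> S / r) ^ CARD('n) * Ex_vol R M"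
        using ev * by (auto elim: eventually_mono)
      have "((\<lambda>S. (1 - \<delta> S / r) ^ CARD('n) * Ex_vol R M) \<longlongrightarrow> (1 - 0 / r) ^ CARD('n) * Ex_vol R M) (at R)"
        "((\<lambda>S. (1 + \<delta> S / r) ^ CARD('n) * Ex_vol R M) \<longlongrightarrow> (1 + 0 / r) ^ CARD('n) * Ex_vol R M) (at R)"
        using c(2) by (intro tendsto_intros \<delta>; simp)+
      then show "((\<lambda>S. (1 - \<delta> S / r) ^ CARD('n) * Ex_vol R M) \<longlongrightarrow> Ex_vol R M) (at R)"
        "((\<lambda>S. (1 + \<delta> S / r) ^ CARD('n) * Ex_vol R M) \<longlongrightarrow> Ex_vol R M) (at R)"
        by simp_all
    qed
  qed
  then show ?thesis
    by (simp add: continuous_on_def)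
qed

lemma uniform_limit_Ex_vol:
  fixes M :: "(real^'n) set"
  assumes Ms: "\<And>i. convex_body (Ms i)" and M: "convex_body M"
    and lim: "(\<lambda>i. hausdorff_distance (Ms i) M) \<longlonglongrightarrow> 0"
  shows "uniform_limit SO (\<lambda>i R. Ex_vol R (Ms i)) (\<lambda>R. Ex_vol R M) sequentially"
proof (rule uniform_limitI)
  fix e :: real assume "0 < e"
  obtain c r where c: "cball c r \<subseteq> M" "0 < r"
    using convex_body_cball[OF M] .
  have "bounded ((\<lambda>R. Ex_vol R M) ` SO)"
    by (intro compact_imp_bounded compact_continuous_image compact_SO
          continuous_on_subset[OF continuous_on_Ex_vol[OF M]] subset_UNIV)
  \<comment> \<open>The volume bounds control relative errors; a bound on the limit volumes over all
    of \<open>SO\<close> turns them into absolute errors uniform in the rotation.\<close>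
  then obtain C where C: "\<And>R. R \<in> SO \<Longrightarrow> Ex_vol R M \<le> C"
    unfolding bounded_iff by (auto simp: Ex_vol_def)
  \<comment> \<open>The factor 2 accounts for the two points in x - R y: each moves by at most the
    Hausdorff distance, and R is an isometry.\<close>
  define \<delta> where "\<delta> i = 2 * hausdorff_distance (Ms i) M" for i
  have ne: "Ms i \<noteq> {}" "M \<noteq> {}" for i
    using Ms[of i] M by (auto simp: convex_body_def)
  have near1: "\<exists>b\<in>M. dist a b \<le> \<delta> i / 2" if "a \<in> Ms i" for a i
    using compact_near_hausdorff_distance[of "Ms i" M a] that Ms[of i] M ne
    by (simp add: convex_body_def \<delta>_def)
  have near2: "\<exists>b\<in>Ms i. dist a b \<le> \<delta> i / 2" if "a \<in> M" for a i
    using compact_near_hausdorff_distance[of M "Ms i" a] that Ms[of i] M ne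
    by (simp add: convex_body_def \<delta>_def hausdorff_distance_commute)
  have \<delta>0: "0 \<le> \<delta> i" for i
    using near2[of _ i] ne(2) by (smt (verit) all_not_in_conv zero_le_dist field_sum_of_halves)
  have dist_diff: "dist (x - R *v y) (x' - R *v y') \<le> \<delta> i"
    if "R \<in> SO" "dist x x' \<le> \<delta> i / 2" "dist y y' \<le> \<delta> i / 2" for R :: "real^'n^'n" and x y x' y' i
  proof -
    have "dist (x - R *v y) (x' - R *v y') \<le> dist x x' + norm (R *v (y - y'))"
      unfolding dist_norm using norm_triangle_ineq4[of "x - x'" "R *v (y - y')"]
      by (simp add: matrix_vector_mult_diff_distrib algebra_simps)
    then show ?thesis
      using that rotation_matrix_norm[OF that(1), of "y - y'"] by (simp add: dist_norm)
  qed
  have \<delta>: "\<delta> \<longlonglongrightarrow> 0"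
    unfolding \<delta>_def using tendsto_mult_right_zero[OF lim] by simp
  have "(\<lambda>i. (1 - (1 - \<delta> i / r) ^ CARD('n)) * C) \<longlonglongrightarrow> (1 - (1 - 0 / r) ^ CARD('n)) * C"
    "(\<lambda>i. ((1 + \<delta> i / r) ^ CARD('n) - 1) * C) \<longlonglongrightarrow> ((1 + 0 / r) ^ CARD('n) - 1) * C"
    using c(2) by (intro tendsto_intros \<delta>; simp)+
  then have "\<forall>\<^sub>F i in sequentially. (1 - (1 - \<delta> i / r) ^ CARD('n)) * C < e"
    "\<forall>\<^sub>F i in sequentially. ((1 + \<delta> i / r) ^ CARD('n) - 1) * C < e"
    using \<open>0 < e\<close> by (auto intro: order_tendstoD(2))
  moreover have "\<forall>\<^sub>F i in sequentially. \<delta> i < r"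
    using order_tendstoD(2)[OF \<delta>, of r] c(2) by auto
  ultimately show "\<forall>\<^sub>F i in sequentially. \<forall>R\<in>SO. dist (Ex_vol R (Ms i)) (Ex_vol R M) < e"
  proof eventually_elim
    case (elim i)
    show ?case
    proof
      fix R :: "real^'n^'n" assume R: "R \<in> SO"
      have 0: "0 \<le> Ex_vol R M" by (simp add: Ex_vol_def)
      have "\<exists>x'\<in>Ms i. \<exists>y'\<in>Ms i. dist (x - R *v y) (x' - R *v y') \<le> \<delta> i" if "x \<in> M" "y \<in> M" for x y
        using near2[of x i] near2[of y i] that dist_diff[OF R] by blast
      moreover have "\<exists>x'\<in>M. \<exists>y'\<in>M. dist (x - R *v y) (x' - R *v y') \<le> \<delta> i" if "x \<in> Ms i" "y \<in> Ms i" for x y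
        using near1[of x i] near1[of y i] that dist_diff[OF R] by blast
      ultimately have
        *: "(1 - \<delta> i / r) ^ CARD('n) * Ex_vol R M \<le> Ex_vol R (Ms i)"
           "Ex_vol R (Ms i) \<le> (1 + \<delta> i / r) ^ CARD('n) * Ex_vol R M"
        using Ex_vol_near_bounds[where R = R and S = R, OF M Ms[of i] c(1) \<delta>0[of i] _ c(2)] elim(3) by auto
      have "(1 - \<delta> i / r) ^ CARD('n) \<le> 1" "1 \<le> (1 + \<delta> i / r) ^ CARD('n)"
        using \<delta>0[of i] elim(3) c(2) by (auto intro!: power_le_one one_le_power)
      then have "(1 - (1 - \<delta> i / r) ^ CARD('n)) * Ex_vol R M \<le> (1 - (1 - \<delta> i / r) ^ CARD('n)) * C"
        "((1 + \<delta> i / r) ^ CARD('n) - 1) * Ex_vol R M \<le> ((1 + \<delta> i / r) ^ CARD('n) - 1) * C"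
        using C[OF R] by (auto intro!: mult_left_mono)
      then show "dist (Ex_vol R (Ms i)) (Ex_vol R M) < e"
        using * elim(1,2) by (simp add: dist_real_def left_diff_distrib)
    qed
  qed
qed

section \<open>Lower semicontinuity of the entropy\<close>

lemma integrable_mult_bounded:
  fixes f h :: "'a \<Rightarrow> real"
  assumes "integrable M f" "h \<in> borel_measurable M" "AE x in M. \<bar>h x\<bar> \<le> C"
  shows "integrable M (\<lambda>x. f x * h x)"
proof (rule Bochner_Integration.integrable_bound)
  show "integrable M (\<lambda>x. C * f x)"
    using assms(1) by simp
  show "(\<lambda>x. f x * h x) \<in> borel_measurable M"
    using assms(1,2) by (intro borel_measurable_times) auto
  show "AE x in M. norm (f x * h x) \<le> norm (C * f x)"
    using assms(3) by eventually_elim (auto simp: abs_mult mult.commute[of C] intro!: mult_left_mono)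
qed

text \<open>\<open>ennreal\<close> cuts off the negative part of the integrand, which can only
  increase the integral.\<close>

lemma ennreal_integral_le_nn_integral:
  fixes f :: "'a \<Rightarrow> real"
  assumes "integrable M f"
  shows "ennreal (\<integral>x. f x \<partial>M) \<le> (\<integral>\<^sup>+x. ennreal (f x) \<partial>M)"
proof -
  have "ennreal (\<integral>x. f x \<partial>M) \<le> ennreal (\<integral>x. max 0 (f x) \<partial>M)"
    using assms by (intro ennreal_leI integral_mono) auto
  also have "\<dots> = (\<integral>\<^sup>+x. ennreal (max 0 (f x)) \<partial>M)"
    using assms by (intro nn_integral_eq_integral[symmetric]) auto
  also have "\<dots> = (\<integral>\<^sup>+x. ennreal (f x) \<partial>M)"
    by (intro nn_integral_cong) (simp add: max_def ennreal_neg)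
  finally show ?thesis .
qed

text \<open>For t > 0 this is exp s \<ge> 1 + s at s = h - 1 - ln t, multiplied by t, with equality
  at h = 1 + ln t. For t = 0 the left side is negative.\<close>

lemma mult_ln_Young:
  fixes t h :: real
  assumes "0 \<le> t"
  shows "t * h - exp (h - 1) \<le> t * ln t"
proof (cases "t = 0")
  case False
  then have "exp (h - 1) = t * exp (h - 1 - ln t)"
    using assms by (simp add: exp_diff)
  moreover have "t * (1 + (h - 1 - ln t)) \<le> t * exp (h - 1 - ln t)"
    using assms by (intro mult_left_mono exp_ge_add_one_self)
  ultimately show ?thesis
    by (simp add: algebra_simps)
qed simp

lemma mult_ln_ge_minus_one:
  fixes t :: real
  assumes "0 \<le> t"
  shows "- 1 \<le> t * ln t"
  using mult_ln_Young[OF assms, of 1] assms by simp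

text \<open>Writing f+ and f- for the positive and negative parts, (f + 1) + f- = f+ + 1 almost
  everywhere, and f- has a finite integral because it is at most 1. Subtracting that integral
  replaces a difference of extended integrals by a single integral of a nonnegative function and a
  real constant.\<close>

lemma (in finite_measure) extended_integral_bounded_below:
  assumes [measurable]: "f \<in> borel_measurable M" and "AE x in M. - 1 \<le> f x"
  shows "extended_integral M f = enn2ereal (\<integral>\<^sup>+x. ennreal (f x + 1) \<partial>M) - ereal (measure M (space M))"
proof -
  let ?N = "\<integral>\<^sup>+x. ennreal (f x + 1) \<partial>M" and ?a = "\<integral>\<^sup>+x. ennreal (f x) \<partial>M" and ?b = "\<integral>\<^sup>+x. ennreal (- f x) \<partial>M"
  have "?N + ?b = (\<integral>\<^sup>+x. ennreal (f x + 1) + ennreal (- f x) \<partial>M)"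
    by (intro nn_integral_add[symmetric]) auto
  also have "\<dots> = (\<integral>\<^sup>+x. ennreal (f x) + 1 \<partial>M)"
  proof (rule nn_integral_cong_AE)
    show "AE x in M. ennreal (f x + 1) + ennreal (- f x) = ennreal (f x) + 1"
      using assms(2)
    proof eventually_elim
      case (elim x)
      then show ?case
        by (cases "0 \<le> f x") (simp_all add: ennreal_neg ennreal_plus[symmetric] ennreal_1[symmetric] del: ennreal_plus ennreal_1)
    qed
  qed
  also have "\<dots> = ?a + measure M (space M)"
    by (subst nn_integral_add) (auto simp: emeasure_eq_measure)
  finally have eq: "?N + ?b = ?a + measure M (space M)" .
  have "?b \<le> (\<integral>\<^sup>+x. 1 \<partial>M)"
    using assms(2) by (intro nn_integral_mono_AE) (auto elim!: eventually_mono simp: ennreal_le_1)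
  then have "?b \<noteq> \<infinity>"
    by (auto simp: emeasure_eq_measure top_unique)
  then obtain b where b: "?b = ennreal b" "0 \<le> b"
    by (cases ?b) auto
  have "enn2ereal ?N + enn2ereal ?b = enn2ereal ?a + enn2ereal (measure M (space M))"
    using eq unfolding plus_ennreal.rep_eq[symmetric] by simp
  then have "enn2ereal ?N + ereal b = enn2ereal ?a + ereal (measure M (space M))"
    using b by (simp add: enn2ereal_ennreal)
  then have "enn2ereal ?a - ereal b = enn2ereal ?N - ereal (measure M (space M))"
    by (cases "enn2ereal ?N"; cases "enn2ereal ?a") auto
  then show ?thesis
    unfolding extended_integral_def b(1) using b(2) by (simp add: enn2ereal_ennreal)
qed

text \<open>For a fixed bounded \<open>h\<close>, Young's inequality bounds the shifted entropy of
  \<open>y i\<close> from below by an affine functional that passes to the weak limit. Thus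
  \<open>?L\<close> dominates that functional at \<open>x\<close> for each \<open>h k\<close>, and
  Fatou's lemma along \<open>k\<close> recovers the shifted entropy of \<open>x\<close>. The shift
  by 1 keeps the integrand of the entropy nonnegative.\<close>

lemma (in finite_measure) mult_ln_nn_integral_lsc:
  assumes conv: "weak_L1_conv M y x" and y: "\<And>i. y i \<in> densities M c" and x: "x \<in> densities M c"
  shows "(\<integral>\<^sup>+z. ennreal (x z * ln (x z) + 1) \<partial>M) \<le> liminf (\<lambda>i. \<integral>\<^sup>+z. ennreal (y i z * ln (y i z) + 1) \<partial>M)"
    (is "_ \<le> ?L")
proof -
  have int: "integrable M x" "integrable M (y i)" and nonneg: "AE z in M. 0 \<le> x z" "AE z in M. 0 \<le> y i z" for i
    using x y[of i] by (auto simp: densities_def)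
  note [measurable] = borel_measurable_integrable[OF int(1)] borel_measurable_integrable[OF int(2)]
  \<comment> \<open>bounded approximations of the maximiser \<open>1 + ln (x z)\<close> in Young's inequality, chosen such that
    the integrands \<open>F k\<close> are nonnegative and Fatou's lemma applies\<close>
  define h where "h k z = (if x z = 0 then - real k else if \<bar>ln (x z)\<bar> \<le> k then 1 + ln (x z) else 0)" for k :: nat and z
  define F where "F k z = x z * h k z - exp (h k z - 1) + 1" for k z
  have h_meas [measurable]: "h k \<in> borel_measurable M" for k
    unfolding h_def by measurable
  have h_bound: "\<bar>h k z\<bar> \<le> k + 1" for k z
    by (auto simp: h_def)
  have exp_int: "integrable M (\<lambda>z. exp (h k z - 1) - 1)" for k
  proof (rule integrable_const_bound[where B = "exp k + 1"])
    have "exp (h k z - 1) \<le> exp k" for z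
      using h_bound[of k z] by (intro exp_le_cancel_iff[THEN iffD2]) simp
    then have "\<bar>exp (h k z - 1) - 1\<bar> \<le> exp k + 1" for z
      by (smt (verit) exp_gt_zero)
    then show "AE z in M. norm (exp (h k z - 1) - 1) \<le> exp k + 1"
      by simp
  qed measurable
  have mult_int: "integrable M (\<lambda>z. f z * h k z)" if "integrable M f" for f k
    using that h_bound by (intro integrable_mult_bounded[where C = "k + 1"]) auto
  \<comment> \<open>In the three cases \<open>F k z\<close> equals 1 - exp (- k - 1), then x ln x +
    1, and finally 1 - exp (- 1).\<close>
  have F_nonneg: "0 \<le> F k z" if "0 \<le> x z" for k z
  proof -
    consider "x z = 0" | "x z \<noteq> 0" "\<bar>ln (x z)\<bar> \<le> k" | "x z \<noteq> 0" "\<not> \<bar>ln (x z)\<bar> \<le> k" by blast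
    then show ?thesis
      using that mult_ln_ge_minus_one[OF that]
      by cases (auto simp: F_def h_def algebra_simps)
  qed
  have F_int: "integrable M (F k)" for k
    unfolding F_def using Bochner_Integration.integrable_diff[OF mult_int[OF int(1)] exp_int, of k k]
    by (simp add: algebra_simps)
  have step: "(\<integral>\<^sup>+z. ennreal (F k z) \<partial>M) \<le> ?L" for k
  proof -
    have eq: "(\<integral>z. f z * h k z - exp (h k z - 1) + 1 \<partial>M) = (\<integral>z. f z * h k z \<partial>M) - (\<integral>z. exp (h k z - 1) - 1 \<partial>M)"
      "integrable M (\<lambda>z. f z * h k z - exp (h k z - 1) + 1)" if "integrable M f" for f
      using Bochner_Integration.integral_diff[OF mult_int[OF that, of k] exp_int[of k]]
        Bochner_Integration.integrable_diff[OF mult_int[OF that, of k] exp_int[of k]]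
      by (simp_all add: algebra_simps)
    have "(\<lambda>i. \<integral>z. y i z * h k z \<partial>M) \<longlonglongrightarrow> (\<integral>z. x z * h k z \<partial>M)"
      using conv h_bound h_meas unfolding weak_L1_conv_def by blast
    then have "(\<lambda>i. ennreal (\<integral>z. y i z * h k z - exp (h k z - 1) + 1 \<partial>M)) \<longlonglongrightarrow> ennreal (\<integral>z. F k z \<partial>M)"
      unfolding F_def eq(1)[OF int(1)] eq(1)[OF int(2)]
      by (intro tendsto_ennrealI tendsto_diff tendsto_const)
    then have "ennreal (\<integral>z. F k z \<partial>M) = liminf (\<lambda>i. ennreal (\<integral>z. y i z * h k z - exp (h k z - 1) + 1 \<partial>M))"
      by (intro lim_imp_Liminf[symmetric]) auto
    also have "\<dots> \<le> ?L"
    proof (intro Liminf_mono always_eventually allI)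
      fix i
      have "ennreal (\<integral>z. y i z * h k z - exp (h k z - 1) + 1 \<partial>M) \<le> (\<integral>\<^sup>+z. ennreal (y i z * h k z - exp (h k z - 1) + 1) \<partial>M)"
        by (rule ennreal_integral_le_nn_integral[OF eq(2)[OF int(2)]])
      also have "\<dots> \<le> (\<integral>\<^sup>+z. ennreal (y i z * ln (y i z) + 1) \<partial>M)"
        using nonneg(2)[of i] by (intro nn_integral_mono_AE) (auto elim!: eventually_mono intro!: ennreal_leI mult_ln_Young)
      finally show "ennreal (\<integral>z. y i z * h k z - exp (h k z - 1) + 1 \<partial>M) \<le> (\<integral>\<^sup>+z. ennreal (y i z * ln (y i z) + 1) \<partial>M)" .
    qed
    also have "ennreal (\<integral>z. F k z \<partial>M) = (\<integral>\<^sup>+z. ennreal (F k z) \<partial>M)"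
      using nonneg(1) F_nonneg by (intro nn_integral_eq_integral[symmetric] F_int) (auto elim!: eventually_mono)
    finally show ?thesis .
  qed
  \<comment> \<open>Where \<open>x\<close> vanishes, \<open>F k z\<close> is 1 minus a geometric
    sequence; elsewhere it equals its limit as soon as \<open>k\<close> exceeds the absolute value
    of \<open>ln (x z)\<close>.\<close>
  have lim: "(\<lambda>k. F k z) \<longlonglongrightarrow> x z * ln (x z) + 1" if "0 \<le> x z" for z
  proof (cases "x z = 0")
    case True
    then have "F k z = 1 - exp (- 1) * exp (- 1) ^ k" for k
      by (simp add: F_def h_def exp_of_nat_mult[symmetric] exp_add[symmetric] algebra_simps)
    moreover have "(\<lambda>k. 1 - exp (- 1) * exp (- 1) ^ k :: real) \<longlonglongrightarrow> 1 - exp (- 1) * 0"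
      by (intro tendsto_intros LIMSEQ_realpow_zero) auto
    ultimately show ?thesis using True by simp
  next
    case False
    have "\<forall>\<^sub>F k in sequentially. \<bar>ln (x z)\<bar> \<le> real k"
      using filterlim_real_sequentially by (simp add: filterlim_at_top)
    then have "\<forall>\<^sub>F k in sequentially. F k z = x z * ln (x z) + 1"
      by (rule eventually_mono) (use False that in \<open>auto simp: F_def h_def algebra_simps\<close>)
    then show ?thesis by (rule tendsto_eventually)
  qed
  have "(\<integral>\<^sup>+z. ennreal (x z * ln (x z) + 1) \<partial>M) = (\<integral>\<^sup>+z. liminf (\<lambda>k. ennreal (F k z)) \<partial>M)"
    using nonneg(1) lim
    by (intro nn_integral_cong_AE) (auto elim!: eventually_mono intro!: lim_imp_Liminf[symmetric] tendsto_ennrealI)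
  also have "\<dots> \<le> liminf (\<lambda>k. \<integral>\<^sup>+z. ennreal (F k z) \<partial>M)"
    by (intro nn_integral_liminf) (auto simp: F_def)
  also have "\<dots> \<le> liminf (\<lambda>k. ?L)"
    by (intro Liminf_mono always_eventually allI step)
  also have "\<dots> = ?L"
    by (simp add: Liminf_const)
  finally show ?thesis .
qed

section \<open>Weak sequential compactness in $L^1$\<close>

lemma integrable_mult_indicator_real:
  fixes f :: "'a \<Rightarrow> real"
  assumes "integrable M f" "A \<in> sets M"
  shows "integrable M (\<lambda>x. f x * indicator A x)"
  using integrable_mult_indicator[OF assms(2,1)] by (simp add: mult.commute)

lemma integral_indicator_disjoint_Un:
  fixes f :: "'a \<Rightarrow> real"
  assumes "integrable M f" "A \<in> sets M" "B \<in> sets M" "A \<inter> B = {}"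
  shows "(\<integral>x. f x * indicator (A \<union> B) x \<partial>M) = (\<integral>x. f x * indicator A x \<partial>M) + (\<integral>x. f x * indicator B x \<partial>M)"
proof -
  have "(\<lambda>x. f x * indicator (A \<union> B) x) = (\<lambda>x. f x * indicator A x + f x * indicator B x)"
    using assms(4) by (auto simp: fun_eq_iff indicator_def)
  then show ?thesis
    using assms by (simp add: integrable_mult_indicator_real)
qed

lemma integral_indicator_disjoint_UN:
  fixes f :: "'a \<Rightarrow> real"
  assumes "integrable M f" "\<And>k. A k \<in> sets M" "disjoint_family A"
  shows "(\<integral>x. f x * indicator (\<Union>k<m::nat. A k) x \<partial>M) = (\<Sum>k<m. \<integral>x. f x * indicator (A k) x \<partial>M)"
proof (induction m)
  case (Suc m)
  have "A m \<inter> A k = {}" if "k < m" for k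
    using disjoint_family_onD[OF assms(3), of m k] that by simp
  then have "A m \<inter> (\<Union>k<m. A k) = {}"
    by blast
  then show ?case
    using integral_indicator_disjoint_Un[OF assms(1), of "A m" "\<Union>k<m. A k"] assms(2) Suc
    by (simp add: lessThan_Suc sets.finite_UN)
qed simp

lemma densities_integral_indicator:
  assumes "f \<in> densities M c" "A \<in> sets M"
  shows "0 \<le> (\<integral>x. f x * indicator A x \<partial>M)" "(\<integral>x. f x * indicator A x \<partial>M) \<le> c"
proof -
  have f: "integrable M f" "AE x in M. 0 \<le> f x" "(\<integral>x. f x \<partial>M) = c"
    using assms(1) by (auto simp: densities_def)
  show "0 \<le> (\<integral>x. f x * indicator A x \<partial>M)"
    using f(2) by (intro integral_nonneg_AE) (auto elim!: eventually_mono)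
  have "(\<integral>x. f x * indicator A x \<partial>M) \<le> (\<integral>x. f x \<partial>M)"
    using f(2) by (intro integral_mono_AE integrable_mult_indicator_real f(1) assms(2))
      (auto elim!: eventually_mono simp: indicator_def)
  then show "(\<integral>x. f x * indicator A x \<partial>M) \<le> c"
    using f(3) by simp
qed

text \<open>The level sets of \<open>J\<close> partition the space into finitely many pieces. This
  reduces integrals against discretised test functions to integrals over sets.\<close>

lemma integral_mult_bounded_int:
  fixes f :: "'a \<Rightarrow> real" and J :: "'a \<Rightarrow> int"
  assumes f: "integrable M f" and J: "J \<in> measurable M (count_space UNIV)"
    and bound: "\<And>x. \<bar>J x\<bar> \<le> N"
  shows "(\<integral>x. f x * of_int (J x) \<partial>M) = (\<Sum>j\<in>{-N..N}. of_int j * (\<integral>x. f x * indicator (J -` {j} \<inter> space M) x \<partial>M))"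
proof -
  have sets: "J -` {j} \<inter> space M \<in> sets M" for j
    using J by (rule measurable_sets) simp
  have "(\<integral>x. f x * of_int (J x) \<partial>M) = (\<integral>x. (\<Sum>j\<in>{-N..N}. of_int j * (f x * indicator (J -` {j} \<inter> space M) x)) \<partial>M)"
  proof (intro Bochner_Integration.integral_cong refl)
    fix x assume x: "x \<in> space M"
    have "J x \<in> {-N..N}" using bound[of x] by auto
    have "(\<Sum>j\<in>{-N..N}. of_int j * (f x * indicator (J -` {j} \<inter> space M) x)) = (\<Sum>j\<in>{-N..N}. if j = J x then of_int j * f x else 0)"
      using x by (intro sum.cong) (auto simp: indicator_def)
    also have "\<dots> = f x * of_int (J x)"
      using \<open>J x \<in> {-N..N}\<close> by simp
    finally show "f x * of_int (J x) = (\<Sum>j\<in>{-N..N}. of_int j * (f x * indicator (J -` {j} \<inter> space M) x))" ..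
  qed
  also have "\<dots> = (\<Sum>j\<in>{-N..N}. of_int j * (\<integral>x. f x * indicator (J -` {j} \<inter> space M) x \<partial>M))"
    using f sets by (subst Bochner_Integration.integral_sum) (auto intro!: integrable_mult_indicator_real)
  finally show ?thesis .
qed

lemma tendsto_uniform_approx:
  fixes a :: "nat \<Rightarrow> 'a::metric_space"
  assumes "\<And>e. e > 0 \<Longrightarrow> \<exists>b m. (b \<longlonglongrightarrow> m) \<and> (\<forall>n. dist (a n) (b n) \<le> e) \<and> dist l m \<le> e"
  shows "a \<longlonglongrightarrow> l"
proof (rule tendstoI)
  fix e :: real assume "e > 0"
  then obtain b m where b: "b \<longlonglongrightarrow> m" "\<And>n. dist (a n) (b n) \<le> e / 3" "dist l m \<le> e / 3"
    using assms[of "e / 3"] by auto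
  have "\<forall>\<^sub>F n in sequentially. dist (b n) m < e / 3"
    using b(1) \<open>e > 0\<close> by (intro tendstoD) simp_all
  then show "\<forall>\<^sub>F n in sequentially. dist (a n) l < e"
  proof eventually_elim
    case (elim n)
    have "dist (a n) l \<le> dist (a n) (b n) + (dist (b n) m + dist m l)"
      using dist_triangle[of "a n" l "b n"] dist_triangle[of "b n" l m] by linarith
    then show ?case
      using b(2)[of n] b(3) elim dist_commute[of m l] by linarith
  qed
qed

text \<open>With no candidate for the limit at hand, the e/3 argument runs through the Cauchy
  criterion.\<close>

lemma convergent_uniform_approx:
  fixes a :: "nat \<Rightarrow> real"
  assumes "\<And>e. e > 0 \<Longrightarrow> \<exists>b. convergent b \<and> (\<forall>n. dist (a n) (b n) \<le> e)"
  shows "convergent a"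
  unfolding Cauchy_convergent_iff[symmetric]
proof (rule metric_CauchyI)
  fix e :: real assume "e > 0"
  then obtain b where b: "convergent b" "\<And>n. dist (a n) (b n) \<le> e / 3"
    using assms[of "e / 3"] by auto
  then have "Cauchy b" by (simp add: Cauchy_convergent_iff)
  then obtain N where N: "\<And>m n. m \<ge> N \<Longrightarrow> n \<ge> N \<Longrightarrow> dist (b m) (b n) < e / 3"
    using \<open>e > 0\<close> unfolding Cauchy_def by (metis zero_less_divide_iff zero_less_numeral)
  have "dist (a m) (a n) < e" if "m \<ge> N" "n \<ge> N" for m n
    using b(2)[of m] b(2)[of n] N[OF that] unfolding dist_real_def by linarith
  then show "\<exists>N. \<forall>m\<ge>N. \<forall>n\<ge>N. dist (a m) (a n) < e" by blast
qed

text \<open>A bounded test function differs almost everywhere by at most 1/k from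
  \<open>J / k\<close> with \<open>J\<close> integer-valued and bounded. All densities have the same
  mass \<open>c\<close>, so the integrals differ by at most c/k, uniformly along the sequence, while
  integrals against \<open>J\<close> are finite combinations of integrals over level sets.\<close>

lemma weak_L1_convI_sets:
  assumes f: "\<And>i. f i \<in> densities M c" and g: "g \<in> densities M c"
    and sets: "\<And>A. A \<in> sets M \<Longrightarrow> (\<lambda>i. \<integral>x. f i x * indicator A x \<partial>M) \<longlonglongrightarrow> (\<integral>x. g x * indicator A x \<partial>M)"
  shows "weak_L1_conv M f g"
  unfolding weak_L1_conv_def
proof (intro ballI impI)
  fix h :: "'a \<Rightarrow> real" assume h [measurable]: "h \<in> borel_measurable M" and "\<exists>C. AE x in M. \<bar>h x\<bar> \<le> C"
  then obtain C where C: "AE x in M. \<bar>h x\<bar> \<le> C" by blast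
  have c: "0 \<le> c"
    using densities_integral_indicator[OF g sets.top] by linarith
  show "(\<lambda>i. \<integral>x. f i x * h x \<partial>M) \<longlonglongrightarrow> (\<integral>x. g x * h x \<partial>M)"
  proof (rule tendsto_uniform_approx)
    fix e :: real assume "e > 0"
    obtain k :: nat where k: "c / e < k" using reals_Archimedean2 by blast
    then have "0 < k"
      using c \<open>e > 0\<close> by (metis divide_nonneg_pos gr0I of_nat_0 not_less)
    \<comment> \<open>Clamping \<open>h\<close> to the range from -C to C changes it on a null set
      only and makes \<open>J\<close> bounded at every point; the 1 added in \<open>N\<close>
      absorbs the rounding down.\<close>
    define J where "J x = \<lfloor>k * max (- C) (min C (h x))\<rfloor>" for x
    define N where "N = \<lceil>k * \<bar>C\<bar>\<rceil> + 1"
    have J [measurable]: "J \<in> measurable M (count_space UNIV)"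
      unfolding J_def by measurable
    have J_bound: "\<bar>J x\<bar> \<le> N" for x
    proof -
      have "\<bar>k * max (- C) (min C (h x))\<bar> \<le> k * \<bar>C\<bar>"
        unfolding abs_mult by (intro mult_mono) auto
      then show ?thesis unfolding J_def N_def by linarith
    qed
    have close: "dist (\<integral>x. u x * h x \<partial>M) (\<integral>x. u x * of_int (J x) \<partial>M / k) \<le> e" if u: "u \<in> densities M c" for u
    proof -
      have u: "integrable M u" "AE x in M. 0 \<le> u x" "(\<integral>x. u x \<partial>M) = c"
        using u by (auto simp: densities_def)
      note [measurable] = borel_measurable_integrable[OF u(1)]
      have int: "integrable M (\<lambda>x. u x * h x)" "integrable M (\<lambda>x. u x * of_int (J x) / k)"
        using integrable_mult_bounded[OF u(1) h C]
          integrable_mult_bounded[OF u(1), of "\<lambda>x. of_int (J x)" "of_int N"] J_bound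
        by (auto simp flip: of_int_abs)
      have "\<bar>\<integral>x. u x * h x - u x * of_int (J x) / k \<partial>M\<bar> \<le> (\<integral>x. u x * (1 / k) \<partial>M)"
      proof (rule order_trans[OF integral_abs_bound], rule integral_mono_AE)
        show "AE x in M. \<bar>u x * h x - u x * of_int (J x) / k\<bar> \<le> u x * (1 / k)"
          using u(2) C
        proof eventually_elim
          case (elim x)
          have "max (- C) (min C (h x)) = h x" using elim by auto
          then have "\<bar>k * h x - of_int (J x)\<bar> \<le> 1" unfolding J_def by (simp only:) linarith
          then have "\<bar>h x - of_int (J x) / k\<bar> \<le> 1 / k"
            using \<open>0 < k\<close> by (simp add: abs_le_iff field_simps)
          then have "\<bar>u x\<bar> * \<bar>h x - of_int (J x) / k\<bar> \<le> u x * (1 / k)"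
            using elim by (intro mult_mono) auto
          then show ?case
            unfolding abs_mult[symmetric] by (simp add: right_diff_distrib)
        qed
      qed (use int u in \<open>auto intro!: integrable_abs Bochner_Integration.integrable_diff\<close>)
      also have "\<dots> \<le> e"
        using u(3) k \<open>0 < k\<close> \<open>e > 0\<close> by (simp add: field_simps)
      finally show ?thesis
        using int by (simp add: dist_real_def)
    qed
    have "(\<lambda>i. (\<integral>x. f i x * of_int (J x) \<partial>M) / k) \<longlonglongrightarrow> (\<integral>x. g x * of_int (J x) \<partial>M) / k"
    proof (rule tendsto_divide[OF _ tendsto_const])
      have "integrable M (f i)" "integrable M g" for i
        using f g by (auto simp: densities_def)
      then show "(\<lambda>i. \<integral>x. f i x * of_int (J x) \<partial>M) \<longlonglongrightarrow> (\<integral>x. g x * of_int (J x) \<partial>M)"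
        by (simp add: integral_mult_bounded_int[OF _ J J_bound])
           (intro tendsto_sum tendsto_mult tendsto_const sets measurable_sets[OF J], simp)
    qed (use \<open>0 < k\<close> in simp)
    then show "\<exists>b m. (b \<longlonglongrightarrow> m) \<and> (\<forall>i. dist (\<integral>x. f i x * h x \<partial>M) (b i) \<le> e) \<and> dist (\<integral>x. g x * h x \<partial>M) m \<le> e"
      using close f g by blast
  qed
qed

text \<open>Uniform integrability is used twice to prevent loss of mass: it lets convergence pass to
  countable disjoint unions, and it makes the limit set function continuous at the empty
  set.\<close>

theorem (in finite_measure) weak_L1_sequentially_compact:
  fixes f :: "nat \<Rightarrow> 'a \<Rightarrow> real"
  assumes G: "countable G" "Int_stable G" "G \<subseteq> Pow (space M)" "sets M = sigma_sets (space M) G"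
    and f: "\<And>i. f i \<in> densities M c"
    and ui: "\<And>e. e > 0 \<Longrightarrow> \<exists>d>0. \<forall>i. \<forall>A\<in>sets M. measure M A < d \<longrightarrow> (\<integral>x. f i x * indicator A x \<partial>M) \<le> e"
  obtains r g where "strict_mono r" "g \<in> densities M c" "weak_L1_conv M (\<lambda>j. f (r j)) g"
proof -
  have int: "integrable M (f i)" and total: "(\<integral>x. f i x \<partial>M) = c" for i
    using f[of i] by (auto simp: densities_def)
  define a where "a i A = (\<integral>x. f i x * indicator A x \<partial>M)" for i A
  have a_bounds: "0 \<le> a i A" "a i A \<le> c" if "A \<in> sets M" for i A
    using densities_integral_indicator[OF f that] by (auto simp: a_def)
  have a_space: "a i (space M) = c" for i
    unfolding a_def total[of i, symmetric] by (rule Bochner_Integration.integral_cong) auto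
  have a_Un: "a i (A \<union> B) = a i A + a i B" if "A \<in> sets M" "B \<in> sets M" "A \<inter> B = {}" for i A B
    unfolding a_def by (rule integral_indicator_disjoint_Un[OF int that])
  have a_Diff: "a i (A - B) = a i A - a i B" if "A \<in> sets M" "B \<in> sets M" "B \<subseteq> A" for i A B
  proof -
    have "B \<union> (A - B) = A" using that by auto
    then show ?thesis using a_Un[of B "A - B" i] that by auto
  qed
  have ui': "\<exists>d>0. \<forall>i. \<forall>A\<in>sets M. measure M A < d \<longrightarrow> a i A \<le> e" if "e > 0" for e
    using ui[OF that] by (simp add: a_def)
  have G_sets: "A \<in> sets M" if "A \<in> G" for A
    using that G(4) by auto
  have "norm (a i A) \<le> c" if "A \<in> G" for i A
    using a_bounds[OF G_sets[OF that]] by simp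
  \<comment> \<open>Each set of the countable \<open>G\<close> gives a sequence of integrals bounded
    by \<open>c\<close>, so one diagonal subsequence serves all of \<open>G\<close>.\<close>
  then obtain r where r: "strict_mono (r :: nat \<Rightarrow> nat)" "\<And>A. A \<in> G \<Longrightarrow> \<exists>l. (\<lambda>n. a (r n) A) \<longlonglongrightarrow> l"
    using function_convergent_subsequence[OF G(1), of a c] by metis
  \<comment> \<open>The sets with convergent integrals form a Dynkin system. Complements are handled
    by the constant total mass. For a disjoint union, the tail beyond finitely many sets has small
    measure, hence small mass for all densities at once, so the finite unions approximate
    uniformly.\<close>
  have conv: "convergent (\<lambda>n. a (r n) A)" if "A \<in> sets M" for A
    using G(2,3) that unfolding G(4)
  proof (induction rule: sigma_sets_induct_disjoint[consumes 3])
    case (basic A)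
    then show ?case using r(2) by (auto simp: convergent_def)
  next
    case empty
    then show ?case by (simp add: a_def convergent_const)
  next
    case (compl A)
    then have "A \<in> sets M" by (simp add: G(4))
    then have "a i (space M - A) = c - a i A" for i
      using a_Diff[of "space M" A i] a_space sets.sets_into_space by auto
    then show ?case using compl.IH by (simp add: convergent_diff convergent_const)
  next
    case (union A)
    have A: "A k \<in> sets M" for k
      using union(2) by (auto simp: G(4))
    let ?B = "\<lambda>m. \<Union>k<m. A k"
    have Un: "(\<Union>m. ?B m) = (\<Union>k. A k)" by blast
    have "(\<lambda>m. measure M (?B m)) \<longlonglongrightarrow> measure M (\<Union>m. ?B m)"
      using A by (intro finite_Lim_measure_incseq) (auto simp: incseq_def intro: order_less_le_trans)
    then have B_lim: "(\<lambda>m. measure M (?B m)) \<longlonglongrightarrow> measure M (\<Union>k. A k)"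
      by (simp only: Un)
    show ?case
    proof (rule convergent_uniform_approx)
      fix e :: real assume "e > 0"
      then obtain d where d: "d > 0" "\<And>i A. A \<in> sets M \<Longrightarrow> measure M A < d \<Longrightarrow> a i A \<le> e"
        using ui' by blast
      obtain m where m: "dist (measure M (?B m)) (measure M (\<Union>k. A k)) < d"
        using B_lim d(1) unfolding lim_sequentially by blast
      have sub: "?B m \<subseteq> (\<Union>k. A k)" by blast
      have ms: "?B m \<in> sets M" "(\<Union>k. A k) \<in> sets M" using A by auto
      have "measure M ((\<Union>k. A k) - ?B m) < d"
        using m finite_measure_Diff[OF ms(2,1) sub] by (simp add: dist_real_def)
      then have diff: "a i ((\<Union>k. A k) - ?B m) \<le> e" for i
        using d(2) ms by auto
      have "dist (a (r n) (\<Union>k. A k)) (a (r n) (?B m)) \<le> e" for n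
        using a_Diff[OF ms(2,1) sub, of "r n"] a_bounds(1)[OF sets.Diff[OF ms(2,1)], of "r n"] diff[of "r n"]
        by (simp add: dist_real_def)
      moreover have "convergent (\<lambda>n. a (r n) (?B m))"
        using union(3) integral_indicator_disjoint_UN[OF int A union(1), of _ m]
        by (simp add: a_def convergent_sum)
      ultimately show "\<exists>b. convergent b \<and> (\<forall>n. dist (a (r n) (\<Union>k. A k)) (b n) \<le> e)"
        by blast
    qed
  qed
  define l where "l A = lim (\<lambda>n. a (r n) A)" for A
  have l: "(\<lambda>n. a (r n) A) \<longlonglongrightarrow> l A" if "A \<in> sets M" for A
    using conv[OF that] by (simp add: l_def convergent_LIMSEQ_iff)
  have l_nonneg: "0 \<le> l A" if "A \<in> sets M" for A
    using l[OF that] a_bounds(1)[OF that] by (intro LIMSEQ_le_const) auto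
  have l_le: "l A \<le> e" if "A \<in> sets M" "\<And>i. a i A \<le> e" for A e
    using l[OF that(1)] that(2) by (intro LIMSEQ_le_const2) auto
  have l_space: "l (space M) = c"
    using l[OF sets.top] unfolding a_space by (simp add: LIMSEQ_const_iff)
  have l_empty: "l {} = 0"
    using l[of "{}"] by (simp add: a_def LIMSEQ_const_iff)
  have l_Un: "l (A \<union> B) = l A + l B" if "A \<in> sets M" "B \<in> sets M" "A \<inter> B = {}" for A B
    using tendsto_add[OF l[OF that(1)] l[OF that(2)]] l[of "A \<union> B"] that a_Un[OF that]
    by (auto intro: LIMSEQ_unique)
  \<comment> \<open>Uniform integrability bounds the integrals of all \<open>a i\<close> over a set
    of small measure by e/2, and the limit inherits this bound. Together with finite additivity,
    continuity at the empty set yields countable additivity.\<close>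
  have l_cont: "(\<lambda>k. ennreal (l (A k))) \<longlonglongrightarrow> 0" if A: "range A \<subseteq> sets M" "decseq A" "(\<Inter>k. A k) = {}" for A :: "nat \<Rightarrow> 'a set"
  proof -
    have "(\<lambda>k. l (A k)) \<longlonglongrightarrow> 0"
    proof (rule LIMSEQ_I)
      fix e :: real assume "e > 0"
      then obtain d where d: "d > 0" "\<And>i A. A \<in> sets M \<Longrightarrow> measure M A < d \<Longrightarrow> a i A \<le> e / 2"
        using ui'[of "e / 2"] by auto
      have "(\<lambda>k. measure M (A k)) \<longlonglongrightarrow> 0"
        using finite_Lim_measure_decseq[OF A(1,2)] A(3) by simp
      then obtain N where N: "\<And>k. k \<ge> N \<Longrightarrow> measure M (A k) < d"
        using d(1) unfolding LIMSEQ_iff by (auto simp: abs_less_iff)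
      have "norm (l (A k) - 0) < e" if "k \<ge> N" for k
      proof -
        have Ak: "A k \<in> sets M" using A(1) by auto
        have "l (A k) \<le> e / 2"
          by (rule l_le[OF Ak d(2)[OF Ak N[OF that]]])
        then show ?thesis using l_nonneg[OF Ak] \<open>e > 0\<close> by simp
      qed
      then show "\<exists>N. \<forall>k\<ge>N. norm (l (A k) - 0) < e" by blast
    qed
    then have "(\<lambda>k. ennreal (l (A k))) \<longlonglongrightarrow> ennreal 0" by (rule tendsto_ennrealI)
    then show ?thesis by simp
  qed
  define N where "N = measure_of (space M) (sets M) (\<lambda>A. ennreal (l A))"
  have sets_N: "sets N = sets M" and space_N: "space N = space M"
    by (simp_all add: N_def sets.space_closed)
  have pos: "positive (sets M) (\<lambda>A. ennreal (l A))"
    by (simp add: positive_def l_empty)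
  have "countably_additive (sets M) (\<lambda>A. ennreal (l A))"
  proof (rule sets.empty_continuous_imp_countably_additive[OF pos])
    show "additive (sets M) (\<lambda>A. ennreal (l A))"
      unfolding additive_def by (simp add: l_Un l_nonneg ennreal_plus)
  qed (use l_cont in auto)
  then have em: "emeasure N A = ennreal (l A)" if "A \<in> sets M" for A
    unfolding N_def using pos that by (intro emeasure_measure_of_sigma sets.sigma_algebra_axioms)
  have "absolutely_continuous M N"
    unfolding absolutely_continuous_def
  proof
    fix A assume "A \<in> null_sets M"
    then have A: "A \<in> sets M" "AE x in M. x \<notin> A" by (auto intro: AE_not_in)
    have "a i A = 0" for i
      unfolding a_def using A(2) by (intro integral_eq_zero_AE) (auto elim!: eventually_mono)
    then show "A \<in> null_sets N"
      using A(1) l_le[OF A(1), of 0] by (auto simp: null_sets_def sets_N em ennreal_neg)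
  qed
  then obtain u where u [measurable]: "u \<in> borel_measurable M" and dens: "density M u = N"
    using Radon_Nikodym[OF _ sets_N] by blast
  have u_int: "(\<integral>\<^sup>+x. u x * indicator A x \<partial>M) = ennreal (l A)" if "A \<in> sets M" for A
    using em[OF that] u that by (simp add: dens[symmetric] emeasure_density)
  have "(\<integral>\<^sup>+x. u x \<partial>M) = (\<integral>\<^sup>+x. u x * indicator (space M) x \<partial>M)"
    by (rule nn_integral_cong) simp
  also have "\<dots> = ennreal (l (space M))"
    by (rule u_int[OF sets.top])
  finally have "(\<integral>\<^sup>+x. u x \<partial>M) \<noteq> \<infinity>"
    by simp
  then have fin: "AE x in M. u x \<noteq> \<infinity>"
    using u by (intro nn_integral_PInf_AE)
  \<comment> \<open>\<open>enn2real\<close> sends infinity to 0; by \<open>fin\<close> this alters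
    \<open>u\<close> on a null set only.\<close>
  define g where "g x = enn2real (u x)" for x
  have g_meas [measurable]: "g \<in> borel_measurable M"
    unfolding g_def by measurable
  have g_ind: "integrable M (\<lambda>x. g x * indicator A x) \<and> (\<integral>x. g x * indicator A x \<partial>M) = l A" if A: "A \<in> sets M" for A
  proof -
    note A [measurable]
    have "(\<integral>\<^sup>+x. ennreal (g x * indicator A x) \<partial>M) = (\<integral>\<^sup>+x. u x * indicator A x \<partial>M)"
      using fin by (intro nn_integral_cong_AE) (auto elim!: eventually_mono simp: g_def indicator_def less_top)
    then have "(\<integral>\<^sup>+x. ennreal (g x * indicator A x) \<partial>M) = ennreal (l A)"
      using u_int[OF A] by simp
    then have "has_bochner_integral M (\<lambda>x. g x * indicator A x) (l A)"
      using l_nonneg[OF A] by (intro has_bochner_integral_nn_integral) (auto simp: g_def)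
    then show ?thesis by (auto simp: has_bochner_integral_iff)
  qed
  have "integrable M g \<and> (\<integral>x. g x \<partial>M) = c"
    using g_ind[OF sets.top] unfolding l_space
    by (simp cong: Bochner_Integration.integrable_cong Bochner_Integration.integral_cong)
  moreover have "0 \<le> g x" for x
    by (simp add: g_def)
  ultimately have g: "g \<in> densities M c"
    by (simp add: densities_def)
  have "weak_L1_conv M (\<lambda>j. f (r j)) g"
    using g_ind l by (intro weak_L1_convI_sets[OF f g]) (simp add: a_def)
  with r(1) g show ?thesis by (rule that)
qed

text \<open>The argument is that of de la Vallee Poussin, using the superlinear growth of t ln t.
  The part of a density below \<open>K\<close> contributes at most \<open>K * measure M A\<close>,
  and above \<open>K\<close> the density is at most its entropy integrand divided by
  \<open>ln K\<close>.\<close>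

lemma (in finite_measure) mult_ln_bounded_uniformly_integrable:
  fixes f :: "'i \<Rightarrow> 'a \<Rightarrow> real"
  assumes f: "\<And>i. f i \<in> densities M c"
    and bound: "\<And>i. (\<integral>\<^sup>+x. ennreal (f i x * ln (f i x) + 1) \<partial>M) \<le> ennreal B" and "e > 0"
  shows "\<exists>d>0. \<forall>i. \<forall>A\<in>sets M. measure M A < d \<longrightarrow> (\<integral>x. f i x * indicator A x \<partial>M) \<le> e"
proof -
  \<comment> \<open>The first summand of the exponent gives |B| / ln K \<le> e/2, and the second
    makes \<open>ln K\<close> positive. The absolute value is taken because \<open>B\<close> may be
    negative.\<close>
  define K where "K = exp (2 * \<bar>B\<bar> / e + 1)"
  have lnK: "ln K = 2 * \<bar>B\<bar> / e + 1" "0 < ln K" "0 < K" "1 \<le> K"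
    using \<open>e > 0\<close> by (auto simp: K_def add_nonneg_pos)
  have small: "\<bar>B\<bar> / ln K \<le> e / 2"
  proof -
    have "2 * \<bar>B\<bar> / e \<le> ln K" using lnK(1) by simp
    then show ?thesis using lnK(2) \<open>e > 0\<close> by (simp add: field_simps)
  qed
  \<comment> \<open>Adding 1 to t ln t makes the last term nonnegative, so the bound also covers t
    \<le> K.\<close>
  have pointwise: "t \<le> K + (t * ln t + 1) / ln K" if "0 \<le> t" for t
  proof (cases "t \<le> K")
    case True
    have "0 \<le> (t * ln t + 1) / ln K"
      using mult_ln_ge_minus_one[OF that] lnK(2) by simp
    then show ?thesis using True by simp
  next
    case False
    then have "t * ln K \<le> t * ln t"
      using lnK(3) by (intro mult_left_mono) auto
    then have "t \<le> (t * ln t + 1) / ln K"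
      using lnK(2) by (simp add: field_simps)
    then show ?thesis using lnK(3) by simp
  qed
  have main: "(\<integral>x. f i x * indicator A x \<partial>M) \<le> K * measure M A + e / 2" if A [measurable]: "A \<in> sets M" for i A
  proof -
    have int: "integrable M (f i)" and nonneg: "AE x in M. 0 \<le> f i x"
      using f[of i] by (auto simp: densities_def)
    note [measurable] = borel_measurable_integrable[OF int]
    have "ennreal (\<integral>x. f i x * indicator A x \<partial>M) = (\<integral>\<^sup>+x. ennreal (f i x * indicator A x) \<partial>M)"
      using nonneg
      by (intro nn_integral_eq_integral[symmetric] integrable_mult_indicator_real int A) (auto elim!: eventually_mono)
    also have "\<dots> \<le> (\<integral>\<^sup>+x. ennreal K * indicator A x + ennreal (1 / ln K) * ennreal (f i x * ln (f i x) + 1) \<partial>M)"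
    proof (rule nn_integral_mono_AE, rule AE_mp[OF nonneg], rule AE_I2, rule impI)
      fix x assume elim: "0 \<le> f i x"
      have "0 \<le> f i x * ln (f i x) + 1" using mult_ln_ge_minus_one[OF elim] by simp
      then have "ennreal K + ennreal (1 / ln K) * ennreal (f i x * ln (f i x) + 1) = ennreal (K + (f i x * ln (f i x) + 1) / ln K)"
        using lnK by (simp flip: ennreal_mult ennreal_plus)
      then show "ennreal (f i x * indicator A x) \<le> ennreal K * indicator A x + ennreal (1 / ln K) * ennreal (f i x * ln (f i x) + 1)"
        using pointwise[OF elim] by (auto simp: indicator_def intro!: ennreal_leI)
    qed
    also have "\<dots> = ennreal K * emeasure M A + ennreal (1 / ln K) * (\<integral>\<^sup>+x. ennreal (f i x * ln (f i x) + 1) \<partial>M)"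
      by (subst nn_integral_add) (auto simp: nn_integral_cmult nn_integral_cmult_indicator)
    also have "\<dots> \<le> ennreal K * emeasure M A + ennreal (1 / ln K) * ennreal \<bar>B\<bar>"
      using bound[of i] by (intro add_left_mono mult_left_mono) (auto intro: order_trans ennreal_leI)
    also have "\<dots> = ennreal (K * measure M A + \<bar>B\<bar> / ln K)"
      using lnK by (simp add: emeasure_eq_measure flip: ennreal_mult ennreal_plus)
    finally have "(\<integral>x. f i x * indicator A x \<partial>M) \<le> K * measure M A + \<bar>B\<bar> / ln K"
      using lnK by (subst (asm) ennreal_le_iff) auto
    then show ?thesis using small by linarith
  qed
  have "(\<integral>x. f i x * indicator A x \<partial>M) \<le> e" if "A \<in> sets M" "measure M A < e / (2 * K)" for i A
  proof -
    have "K * measure M A \<le> e / 2" using that(2) lnK(3) by (simp add: field_simps)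
    then show ?thesis using main[OF that(1), of i] by simp
  qed
  moreover have "0 < e / (2 * K)" using \<open>e > 0\<close> lnK(3) by simp
  ultimately show ?thesis by blast
qed

text \<open>Finite intersections of a countable basis form a family that is still countable,
  consists of open sets, generates the Borel sets and is closed under intersection. Its traces on
  \<open>S\<close> inherit these closure and generation properties.\<close>

lemma countable_Int_stable_generator_restrict_borel:
  fixes S :: "'a::second_countable_topology set"
  assumes "S \<in> sets borel"
  obtains G where "countable G" "Int_stable G" "G \<subseteq> Pow S" "sets (restrict_space borel S) = sigma_sets S G"
proof -
  obtain B :: "'a set set" where B: "countable B" "topological_basis B"
    using ex_countable_basis by blast
  define H where "H = Inter ` {F. finite F \<and> F \<subseteq> B}"
  have H_open: "open X" if "X \<in> H" for X
    using that topological_basis_open[OF B(2)] by (auto simp: H_def intro!: open_Inter)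
  have "B \<subseteq> H"
  proof
    fix X assume "X \<in> B"
    then have "{X} \<in> {F. finite F \<and> F \<subseteq> B}" by simp
    then show "X \<in> H" unfolding H_def by (metis Inter_insert Inter_empty Int_UNIV_right image_eqI)
  qed
  then have "topological_basis H"
    using B(2) H_open unfolding topological_basis_def by (meson order_trans)
  moreover have H_count: "countable H"
    unfolding H_def using B(1) by (intro countable_image countable_Collect_finite_subset)
  ultimately have borel: "sets (borel :: 'a measure) = sigma_sets UNIV H"
    by (simp add: borel_eq_countable_basis sets_measure_of)
  have H_Int: "X \<inter> Y \<in> H" if "X \<in> H" "Y \<in> H" for X Y
  proof -
    obtain F where F: "X = \<Inter>F" "F \<in> {F. finite F \<and> F \<subseteq> B}"
      using \<open>X \<in> H\<close> unfolding H_def by (rule imageE)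
    obtain F' where F': "Y = \<Inter>F'" "F' \<in> {F. finite F \<and> F \<subseteq> B}"
      using \<open>Y \<in> H\<close> unfolding H_def by (rule imageE)
    have "X \<inter> Y = \<Inter>(F \<union> F')"
      unfolding F(1) F'(1) by (rule Inter_Un_distrib[symmetric])
    moreover have "F \<union> F' \<in> {F. finite F \<and> F \<subseteq> B}"
      using F(2) F'(2) by simp
    ultimately show ?thesis
      unfolding H_def by (rule image_eqI)
  qed
  show ?thesis
  proof
    show "countable ((\<inter>) S ` H)" using H_count by simp
    show "Int_stable ((\<inter>) S ` H)"
    proof (rule Int_stableI)
      fix X Y assume "X \<in> (\<inter>) S ` H" "Y \<in> (\<inter>) S ` H"
      then obtain X' Y' where "X' \<in> H" "Y' \<in> H" "X = S \<inter> X'" "Y = S \<inter> Y'" by auto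
      then have "X \<inter> Y = S \<inter> (X' \<inter> Y')" "X' \<inter> Y' \<in> H" using H_Int by auto
      then show "X \<inter> Y \<in> (\<inter>) S ` H" by blast
    qed
    show "(\<inter>) S ` H \<subseteq> Pow S" by auto
    show "sets (restrict_space borel S) = sigma_sets S ((\<inter>) S ` H)"
      using assms unfolding sets_restrict_space borel by (intro sigma_sets_Int) auto
  qed
qed

section \<open>The interaction term\<close>

lemma density_integral_bound:
  assumes u: "u \<in> densities M c" and b: "b \<in> borel_measurable M" "\<And>x. x \<in> space M \<Longrightarrow> \<bar>b x\<bar> \<le> B"
  shows "integrable M (\<lambda>x. u x * b x)" "\<bar>\<integral>x. u x * b x \<partial>M\<bar> \<le> c * B"
proof -
  have u: "integrable M u" "AE x in M. 0 \<le> u x" "(\<integral>x. u x \<partial>M) = c"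
    using u by (auto simp: densities_def)
  show int: "integrable M (\<lambda>x. u x * b x)"
    using b by (intro integrable_mult_bounded[OF u(1)]) auto
  have "\<bar>\<integral>x. u x * b x \<partial>M\<bar> \<le> (\<integral>x. u x * B \<partial>M)"
  proof (rule order_trans[OF integral_abs_bound], rule integral_mono_AE)
    show "AE x in M. \<bar>u x * b x\<bar> \<le> u x * B"
      using u(2) AE_space by eventually_elim (auto simp: abs_mult intro!: mult_left_mono b(2))
  qed (use int u(1) in auto)
  then show "\<bar>\<integral>x. u x * b x \<partial>M\<bar> \<le> c * B"
    using u(3) by simp
qed

lemma densities_const_nonneg: "u \<in> densities M c \<Longrightarrow> 0 \<le> c"
  by (auto simp: densities_def intro: integral_nonneg_AE)

lemma weak_L1_convD:
  assumes "weak_L1_conv M f g" "h \<in> borel_measurable M" "\<And>x. x \<in> space M \<Longrightarrow> \<bar>h x\<bar> \<le> C"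
  shows "(\<lambda>i. \<integral>x. f i x * h x \<partial>M) \<longlonglongrightarrow> (\<integral>x. g x * h x \<partial>M)"
proof -
  have "AE x in M. \<bar>h x\<bar> \<le> C"
    using assms(3) by (rule AE_I2)
  then have "\<exists>C. AE x in M. \<bar>h x\<bar> \<le> C" ..
  then show ?thesis
    using assms(1,2) by (simp add: weak_L1_conv_def)
qed

lemma borel_measurable_continuous_on_space:
  fixes f :: "'a::topological_space \<Rightarrow> real"
  assumes "sets M = sets (restrict_space borel (space M))" "continuous_on (space M) f"
  shows "f \<in> borel_measurable M"
  using borel_measurable_continuous_on_restrict[OF assms(2)] measurable_cong_sets[OF assms(1) refl, of borel] by blast

text \<open>A nonnegative density of mass \<open>c\<close> averages a kernel difference of size at
  most \<open>e\<close> to at most \<open>c * e\<close>. Two points and two kernels occur so that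
  the estimate covers both moving the point under one kernel and changing the kernel at one point.
  The bound depends on the density only through \<open>c\<close>.\<close>

lemma density_potential_oscillation:
  fixes k :: "'a::topological_space \<times> 'a \<Rightarrow> real"
  assumes u: "u \<in> densities M c" and borel: "sets M = sets (restrict_space borel (space M))"
    and compact: "compact (space M)" and k: "continuous_on (space M \<times> space M) k" "continuous_on (space M \<times> space M) k'"
    and R: "R \<in> space M" "R' \<in> space M" and osc: "\<And>S. S \<in> space M \<Longrightarrow> \<bar>k (R, S) - k' (R', S)\<bar> \<le> e"
  shows "\<bar>(\<integral>S. u S * k (R, S) \<partial>M) - (\<integral>S. u S * k' (R', S) \<partial>M)\<bar> \<le> c * e"
proof -
  have cont: "continuous_on (space M) (\<lambda>S. q (R, S))" if "continuous_on (space M \<times> space M) q" "R \<in> space M" for R and q :: "'a \<times> 'a \<Rightarrow> real"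
    using that by (intro continuous_on_compose2[OF that(1)] continuous_intros) auto
  have int: "integrable M (\<lambda>S. u S * q (R, S))" if "continuous_on (space M \<times> space M) q" "R \<in> space M" for R and q :: "'a \<times> 'a \<Rightarrow> real"
  proof -
    have "bounded ((\<lambda>S. q (R, S)) ` space M)"
      by (intro compact_imp_bounded compact_continuous_image compact cont that)
    then obtain B where "\<And>S. S \<in> space M \<Longrightarrow> \<bar>q (R, S)\<bar> \<le> B"
      unfolding bounded_iff by auto
    then show ?thesis
      by (intro density_integral_bound(1)[OF u] borel_measurable_continuous_on_space[OF borel] cont that)
  qed
  have "(\<integral>S. u S * k (R, S) \<partial>M) - (\<integral>S. u S * k' (R', S) \<partial>M) = (\<integral>S. u S * (k (R, S) - k' (R', S)) \<partial>M)"
    using int k R by (simp add: right_diff_distrib)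
  also have "\<bar>\<dots>\<bar> \<le> c * e"
    by (intro density_integral_bound(2)[OF u] borel_measurable_continuous_on_space[OF borel] continuous_on_diff cont k R osc)
  finally show ?thesis .
qed

lemma density_potential_continuous:
  fixes k :: "'a::metric_space \<times> 'a \<Rightarrow> real"
  assumes u: "u \<in> densities M c" and borel: "sets M = sets (restrict_space borel (space M))"
    and compact: "compact (space M)" and k: "continuous_on (space M \<times> space M) k"
  shows "continuous_on (space M) (\<lambda>R. \<integral>S. u S * k (R, S) \<partial>M)"
  unfolding continuous_on_iff
proof (intro ballI allI impI)
  fix R and e :: real assume R: "R \<in> space M" and "e > 0"
  have c: "0 \<le> c" by (rule densities_const_nonneg[OF u])
  \<comment> \<open>Dividing by c + 1 allows for c = 0 and makes the final inequality
    strict.\<close>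
  have "e / (c + 1) > 0" using \<open>e > 0\<close> c by simp
  moreover have "uniformly_continuous_on (space M \<times> space M) k"
    using k compact by (intro compact_uniformly_continuous compact_Times)
  ultimately obtain d where d: "d > 0"
    "\<And>p q. p \<in> space M \<times> space M \<Longrightarrow> q \<in> space M \<times> space M \<Longrightarrow> dist q p < d \<Longrightarrow> dist (k q) (k p) < e / (c + 1)"
    unfolding uniformly_continuous_on_def by metis
  have "dist (\<integral>S. u S * k (R', S) \<partial>M) (\<integral>S. u S * k (R, S) \<partial>M) < e" if "R' \<in> space M" "dist R' R < d" for R'
  proof -
    have "\<bar>(\<integral>S. u S * k (R', S) \<partial>M) - (\<integral>S. u S * k (R, S) \<partial>M)\<bar> \<le> c * (e / (c + 1))"
    proof (rule density_potential_oscillation[OF u borel compact k k that(1) R])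
      fix S assume "S \<in> space M"
      then show "\<bar>k (R', S) - k (R, S)\<bar> \<le> e / (c + 1)"
        using d(2)[of "(R, S)" "(R', S)"] R that by (simp add: dist_real_def dist_Pair_Pair)
    qed
    also have "\<dots> < e"
      using \<open>e > 0\<close> c by (simp add: field_simps)
    finally show ?thesis by (simp add: dist_real_def)
  qed
  then show "\<exists>d>0. \<forall>R'\<in>space M. dist R' R < d \<longrightarrow> dist (\<integral>S. u S * k (R', S) \<partial>M) (\<integral>S. u S * k (R, S) \<partial>M) < e"
    using d(1) by blast
qed

text \<open>At a fixed point the kernel is a bounded test function, so weak convergence gives
  pointwise convergence of the potentials. Uniform continuity of \<open>k\<close> makes the
  potentials of all densities of mass \<open>c\<close> equicontinuous, and compactness upgrades
  pointwise to uniform convergence.\<close>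

lemma weak_L1_conv_potential_uniform_limit:
  fixes k :: "'a::metric_space \<times> 'a \<Rightarrow> real"
  assumes y: "\<And>i. y i \<in> densities M c" and x: "x \<in> densities M c" and conv: "weak_L1_conv M y x"
    and borel: "sets M = sets (restrict_space borel (space M))" and compact: "compact (space M)"
    and k: "continuous_on (space M \<times> space M) k" and ks: "\<And>i. continuous_on (space M \<times> space M) (ks i)"
    and lim: "uniform_limit (space M \<times> space M) ks k sequentially"
  shows "uniform_limit (space M) (\<lambda>i R. \<integral>S. y i S * ks i (R, S) \<partial>M) (\<lambda>R. \<integral>S. x S * k (R, S) \<partial>M) sequentially"
proof (rule uniform_limitI)
  fix e :: real assume "e > 0"
  have c: "0 \<le> c" by (rule densities_const_nonneg[OF x])
  \<comment> \<open>The final estimate has three errors of size at most c e' (change of kernel, and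
    two moves to a net point) and one below e' (convergence at that point), in total less than (3 c
    + 2) e' = e.\<close>
  define e' where "e' = e / (3 * c + 2)"
  have e': "e' > 0" using \<open>e > 0\<close> c by (simp add: e'_def)
  have e'_sum: "c * e' + (c * e' + e' + c * e') < e"
  proof -
    have "(3 * c + 1) * e' < (3 * c + 2) * e'" using e' by simp
    also have "\<dots> = e" using c by (simp add: e'_def)
    finally show ?thesis by (simp add: algebra_simps)
  qed
  have "uniformly_continuous_on (space M \<times> space M) k"
    using k compact by (intro compact_uniformly_continuous compact_Times)
  then obtain d where d: "d > 0"
    "\<And>p q. p \<in> space M \<times> space M \<Longrightarrow> q \<in> space M \<times> space M \<Longrightarrow> dist q p < d \<Longrightarrow> dist (k q) (k p) < e'"
    unfolding uniformly_continuous_on_def using e' by metis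
  have osc: "\<bar>(\<integral>S. u S * k (R, S) \<partial>M) - (\<integral>S. u S * k (R', S) \<partial>M)\<bar> \<le> c * e'"
    if "u \<in> densities M c" "R \<in> space M" "R' \<in> space M" "dist R R' < d" for u R R'
  proof (rule density_potential_oscillation[OF that(1) borel compact k k that(2,3)])
    fix S assume "S \<in> space M"
    then show "\<bar>k (R, S) - k (R', S)\<bar> \<le> e'"
      using d(2)[of "(R', S)" "(R, S)"] that by (simp add: dist_real_def dist_Pair_Pair)
  qed
  obtain C where C: "C \<subseteq> space M" "finite C" "space M \<subseteq> (\<Union>R\<in>C. ball R d)"
  proof (rule compactE_image[OF compact, of "space M" "\<lambda>R. ball R d"])
    show "space M \<subseteq> (\<Union>R\<in>space M. ball R d)" using d(1) by force
  qed auto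
  have ptwise: "\<forall>\<^sub>F i in sequentially. dist (\<integral>S. y i S * k (R, S) \<partial>M) (\<integral>S. x S * k (R, S) \<partial>M) < e'" if "R \<in> space M" for R
  proof -
    have cont: "continuous_on (space M) (\<lambda>S. k (R, S))"
      using that by (intro continuous_on_compose2[OF k] continuous_intros) auto
    then have "bounded ((\<lambda>S. k (R, S)) ` space M)"
      by (intro compact_imp_bounded compact_continuous_image compact)
    then obtain B where B: "\<And>S. S \<in> space M \<Longrightarrow> \<bar>k (R, S)\<bar> \<le> B"
      unfolding bounded_iff by auto
    have "(\<lambda>i. \<integral>S. y i S * k (R, S) \<partial>M) \<longlonglongrightarrow> (\<integral>S. x S * k (R, S) \<partial>M)"
      by (rule weak_L1_convD[OF conv borel_measurable_continuous_on_space[OF borel cont] B])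
    then show ?thesis using e' by (rule tendstoD)
  qed
  \<comment> \<open>Convergence at each point is automatically uniform over the finite net
    \<open>C\<close>.\<close>
  have "\<forall>\<^sub>F i in sequentially. \<forall>R\<in>C. dist (\<integral>S. y i S * k (R, S) \<partial>M) (\<integral>S. x S * k (R, S) \<partial>M) < e'"
    using C(1,2) ptwise by (intro eventually_ball_finite) auto
  moreover have "\<forall>\<^sub>F i in sequentially. \<forall>p\<in>space M \<times> space M. dist (ks i p) (k p) < e'"
    using lim e' by (simp add: uniform_limit_iff)
  ultimately show "\<forall>\<^sub>F i in sequentially. \<forall>R\<in>space M. dist (\<integral>S. y i S * ks i (R, S) \<partial>M) (\<integral>S. x S * k (R, S) \<partial>M) < e"
  proof eventually_elim
    case (elim i)
    show ?case
    proof
      fix R assume R: "R \<in> space M"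
      then obtain R' where R': "R' \<in> C" "dist R' R < d" using C(3) by auto
      then have R'_space: "R' \<in> space M" using C(1) by auto
      have "\<bar>ks i (R, S) - k (R, S)\<bar> \<le> e'" if "S \<in> space M" for S
        using elim(2) R that by (force simp: dist_real_def)
      then have "\<bar>(\<integral>S. y i S * ks i (R, S) \<partial>M) - (\<integral>S. y i S * k (R, S) \<partial>M)\<bar> \<le> c * e'"
        by (rule density_potential_oscillation[OF y borel compact ks k R R])
      moreover have "\<bar>(\<integral>S. y i S * k (R', S) \<partial>M) - (\<integral>S. y i S * k (R, S) \<partial>M)\<bar> \<le> c * e'"
        by (rule osc[OF y R'_space R R'(2)])
      moreover have "\<bar>(\<integral>S. x S * k (R', S) \<partial>M) - (\<integral>S. x S * k (R, S) \<partial>M)\<bar> \<le> c * e'"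
        by (rule osc[OF x R'_space R R'(2)])
      moreover have "\<bar>(\<integral>S. y i S * k (R', S) \<partial>M) - (\<integral>S. x S * k (R', S) \<partial>M)\<bar> < e'"
        using elim(1) R'(1) by (simp add: dist_real_def)
      ultimately show "dist (\<integral>S. y i S * ks i (R, S) \<partial>M) (\<integral>S. x S * k (R, S) \<partial>M) < e"
        using e'_sum unfolding dist_real_def by linarith
    qed
  qed
qed

text \<open>A product of two weakly convergent factors need not converge, but the inner integral,
  the potential, converges uniformly. The outer integral thus pairs a weakly convergent density with
  a uniformly convergent bounded function.\<close>

lemma weak_L1_conv_interaction_tendsto:
  fixes k :: "'a::metric_space \<times> 'a \<Rightarrow> real"
  assumes y: "\<And>i. y i \<in> densities M c" and x: "x \<in> densities M c" and conv: "weak_L1_conv M y x"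
    and borel: "sets M = sets (restrict_space borel (space M))" and compact: "compact (space M)"
    and k: "continuous_on (space M \<times> space M) k" and ks: "\<And>i. continuous_on (space M \<times> space M) (ks i)"
    and lim: "uniform_limit (space M \<times> space M) ks k sequentially"
  shows "(\<lambda>i. \<integral>R. (\<integral>S. y i R * y i S * ks i (R, S) \<partial>M) \<partial>M) \<longlonglongrightarrow> (\<integral>R. (\<integral>S. x R * x S * k (R, S) \<partial>M) \<partial>M)"
proof -
  let ?p = "\<lambda>u k R. \<integral>S. u S * k (R, S) \<partial>M"
  have "continuous_on (space M) (?p x k)" "continuous_on (space M) (?p (y i) (ks i))" for i
    using density_potential_continuous[OF x borel compact k] density_potential_continuous[OF y borel compact ks] by auto
  note cont = this
  have "bounded (?p x k ` space M)" "bounded (?p (y i) (ks i) ` space M)" for i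
    by (intro compact_imp_bounded compact_continuous_image compact cont)+
  then have bdd: "\<exists>B. \<forall>R\<in>space M. \<bar>?p x k R\<bar> \<le> B" "\<exists>B. \<forall>R\<in>space M. \<bar>?p (y i) (ks i) R\<bar> \<le> B" for i
    unfolding bounded_iff by auto
  note meas = borel_measurable_continuous_on_space[OF borel cont(1)] borel_measurable_continuous_on_space[OF borel cont(2)]
  have c: "0 \<le> c" by (rule densities_const_nonneg[OF x])
  obtain B where B: "\<forall>R\<in>space M. \<bar>?p x k R\<bar> \<le> B"
    using bdd(1) ..
  have "(\<lambda>i. \<integral>R. y i R * ?p x k R \<partial>M) \<longlonglongrightarrow> (\<integral>R. x R * ?p x k R \<partial>M)"
    using B by (intro weak_L1_convD[OF conv meas(1)]) blast
  \<comment> \<open>Replacing the potential of \<open>y i\<close> by its limit costs at most the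
    mass \<open>c\<close> times their uniform distance.\<close>
  moreover have "(\<lambda>i. (\<integral>R. y i R * ?p (y i) (ks i) R \<partial>M) - (\<integral>R. y i R * ?p x k R \<partial>M)) \<longlonglongrightarrow> 0"
  proof (rule tendstoI)
    fix e :: real assume "e > 0"
    have "\<forall>\<^sub>F i in sequentially. \<forall>R\<in>space M. dist (?p (y i) (ks i) R) (?p x k R) < e / (c + 1)"
      using weak_L1_conv_potential_uniform_limit[OF assms] \<open>e > 0\<close> c by (simp add: uniform_limit_iff)
    then show "\<forall>\<^sub>F i in sequentially. dist ((\<integral>R. y i R * ?p (y i) (ks i) R \<partial>M) - (\<integral>R. y i R * ?p x k R \<partial>M)) 0 < e"
    proof eventually_elim
      case (elim i)
      obtain B' where B': "\<forall>R\<in>space M. \<bar>?p (y i) (ks i) R\<bar> \<le> B'"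
        using bdd(2) ..
      have int: "integrable M (\<lambda>R. y i R * ?p x k R)" "integrable M (\<lambda>R. y i R * ?p (y i) (ks i) R)"
        using B B' by (intro density_integral_bound(1)[OF y meas(1), of B] density_integral_bound(1)[OF y meas(2), of i B']; blast)+
      have "(\<integral>R. y i R * ?p (y i) (ks i) R \<partial>M) - (\<integral>R. y i R * ?p x k R \<partial>M) = (\<integral>R. y i R * (?p (y i) (ks i) R - ?p x k R) \<partial>M)"
        using int by (simp add: right_diff_distrib)
      also have "\<bar>\<dots>\<bar> \<le> c * (e / (c + 1))"
        using elim by (intro density_integral_bound(2)[OF y] borel_measurable_diff meas) (auto simp: dist_real_def less_imp_le)
      also have "\<dots> < e"
        using \<open>e > 0\<close> c by (simp add: field_simps)
      finally show ?case by simp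
    qed
  qed
  ultimately have "(\<lambda>i. \<integral>R. y i R * ?p (y i) (ks i) R \<partial>M) \<longlonglongrightarrow> (\<integral>R. x R * ?p x k R \<partial>M)"
    by (rule Lim_transform)
  then show ?thesis
    by (simp add: mult.assoc)
qed

section \<open>Gamma-convergence and equicoercivity\<close>

lemma continuous_on_Ex_vol_kernel:
  assumes "convex_body M"
  shows "continuous_on A (\<lambda>p :: (real^'n^'n) \<times> (real^'n^'n). Ex_vol (fst p ** transpose (snd p)) M)"
  by (rule continuous_on_compose2[OF continuous_on_Ex_vol[OF assms]])
     (intro continuous_on_matrix_mult continuous_on_transpose continuous_on_fst continuous_on_snd continuous_on_id subset_UNIV)+

lemma uniform_limit_Ex_vol_kernel:
  fixes M :: "(real^'n) set"
  assumes "\<And>i. convex_body (Ms i)" "convex_body M" "(\<lambda>i. hausdorff_distance (Ms i) M) \<longlonglongrightarrow> 0"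
  shows "uniform_limit (SO \<times> SO) (\<lambda>i p. Ex_vol (fst p ** transpose (snd p)) (Ms i))
    (\<lambda>p. Ex_vol (fst p ** transpose (snd p)) M) sequentially"
proof (rule uniform_limitI)
  fix e :: real assume "e > 0"
  then have "\<forall>\<^sub>F i in sequentially. \<forall>R\<in>SO. dist (Ex_vol R (Ms i)) (Ex_vol R M) < e"
    using uniform_limit_Ex_vol[OF assms] by (simp add: uniform_limit_iff)
  then show "\<forall>\<^sub>F i in sequentially. \<forall>p\<in>SO \<times> SO.
      dist (Ex_vol (fst p ** transpose (snd p)) (Ms i)) (Ex_vol (fst p ** transpose (snd p)) M) < e"
    by (rule eventually_mono) (auto intro: SO_mult_transpose)
qed

text \<open>The energy is split into a real summand and a nonnegative, possibly infinite one, so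
  that later limits never meet a difference of infinities.\<close>

lemma onsager_energy_eq:
  fixes M :: "(real^'n^'n) measure"
  assumes "finite_measure M" "\<rho> \<in> densities M c"
  shows "onsager_energy M K \<rho> =
    ereal (1/2 * (\<integral>R. (\<integral>S. \<rho> R * \<rho> S * Ex_vol (R ** transpose S) K \<partial>M) \<partial>M) - measure M (space M)) +
    enn2ereal (\<integral>\<^sup>+R. ennreal (\<rho> R * ln (\<rho> R) + 1) \<partial>M)"
proof -
  have \<rho>: "integrable M \<rho>" "AE R in M. 0 \<le> \<rho> R"
    using assms(2) by (auto simp: densities_def)
  note [measurable] = borel_measurable_integrable[OF \<rho>(1)]
  have "extended_integral M (\<lambda>R. \<rho> R * ln (\<rho> R)) =
    enn2ereal (\<integral>\<^sup>+R. ennreal (\<rho> R * ln (\<rho> R) + 1) \<partial>M) - ereal (measure M (space M))"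
    using \<rho>(2) by (intro finite_measure.extended_integral_bounded_below assms(1)) (auto elim!: eventually_mono intro: mult_ln_ge_minus_one)
  then show ?thesis
    unfolding onsager_energy_def
    by (cases "enn2ereal (\<integral>\<^sup>+R. ennreal (\<rho> R * ln (\<rho> R) + 1) \<partial>M)") auto
qed

text \<open>Since excluded volumes are nonnegative, an upper bound on the energy bounds the entropy
  alone.\<close>

lemma interaction_nonneg:
  fixes M :: "(real^'n^'n) measure"
  assumes "\<rho> \<in> densities M c"
  shows "0 \<le> (\<integral>R. (\<integral>S. \<rho> R * \<rho> S * Ex_vol (R ** transpose S) K \<partial>M) \<partial>M)"
proof -
  have \<rho>: "AE R in M. 0 \<le> \<rho> R"
    using assms by (auto simp: densities_def)
  show ?thesis
  proof (rule integral_nonneg_AE, rule AE_mp[OF \<rho>], rule AE_I2, rule impI)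
    fix R assume "0 \<le> \<rho> R"
    with \<rho> show "0 \<le> (\<integral>S. \<rho> R * \<rho> S * Ex_vol (R ** transpose S) K \<partial>M)"
      by (intro integral_nonneg_AE) (auto elim!: eventually_mono simp: Ex_vol_def)
  qed
qed

theorem theorem4p2:
  fixes \<mu> :: "(real^'n^'n) measure"
    and \<rho>\<^sub>0 :: real
    and Ms :: "nat \<Rightarrow> (real^'n) set"
    and M :: "(real^'n) set"
  assumes "haar_measure_SO \<mu>"
    and "\<rho>\<^sub>0 > 0"
    and "\<And>i. convex_body (Ms i)"
    and "convex_body M"
    and "(\<lambda>i. hausdorff_distance (Ms i) M) \<longlonglongrightarrow> 0"
  shows "gamma_converges (densities \<mu> \<rho>\<^sub>0) (weak_L1_conv \<mu>)
           (\<lambda>i. onsager_energy \<mu> (Ms i)) (onsager_energy \<mu> M) \<and>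
         equicoercive (densities \<mu> \<rho>\<^sub>0) (weak_L1_conv \<mu>) (\<lambda>i. onsager_energy \<mu> (Ms i))"
proof -
  have space: "space \<mu> = SO" and sets: "sets \<mu> = sets (restrict_space borel SO)"
    and fin: "finite_measure \<mu>"
    using assms(1) by (auto simp: haar_measure_SO_def)
  interpret finite_measure \<mu> by (rule fin)
  define I where "I K \<rho> = (\<integral>R. (\<integral>S. \<rho> R * \<rho> S * Ex_vol (R ** transpose S) K \<partial>\<mu>) \<partial>\<mu>)" for K and \<rho> :: "real^'n^'n \<Rightarrow> real"
  define N where "N \<rho> = (\<integral>\<^sup>+R. ennreal (\<rho> R * ln (\<rho> R) + 1) \<partial>\<mu>)" for \<rho> :: "real^'n^'n \<Rightarrow> real"
  \<comment> \<open>\<open>J\<close> collects the real part of the energy: the interaction minus the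
    constant introduced by shifting the entropy integrand by 1 in \<open>N\<close>.\<close>
  define J where "J K \<rho> = 1/2 * I K \<rho> - measure \<mu> (space \<mu>)" for K and \<rho> :: "real^'n^'n \<Rightarrow> real"
  have energy: "onsager_energy \<mu> K \<rho> = ereal (J K \<rho>) + enn2ereal (N \<rho>)" if "\<rho> \<in> densities \<mu> \<rho>\<^sub>0" for K \<rho>
    using onsager_energy_eq[OF fin that, of K] by (simp add: I_def J_def N_def)
  have J_lim: "(\<lambda>i. ereal (J (Ms i) (y i))) \<longlonglongrightarrow> ereal (J M x)"
    if "\<And>i. y i \<in> densities \<mu> \<rho>\<^sub>0" "x \<in> densities \<mu> \<rho>\<^sub>0" "weak_L1_conv \<mu> y x" for y x
  proof -
    have "(\<lambda>i. I (Ms i) (y i)) \<longlonglongrightarrow> I M x"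
      using weak_L1_conv_interaction_tendsto[OF that, unfolded space,
          OF sets compact_SO continuous_on_Ex_vol_kernel[OF assms(4)]
            continuous_on_Ex_vol_kernel[OF assms(3)] uniform_limit_Ex_vol_kernel[OF assms(3-5)]]
      by (simp add: I_def)
    then show ?thesis
      unfolding J_def by (intro tendsto_intros)
  qed
  have "onsager_energy \<mu> M x \<le> liminf (\<lambda>i. onsager_energy \<mu> (Ms i) (y i))"
    if "x \<in> densities \<mu> \<rho>\<^sub>0" "\<And>i. y i \<in> densities \<mu> \<rho>\<^sub>0" "weak_L1_conv \<mu> y x" for x y
  proof -
    have "N x \<le> liminf (\<lambda>i. N (y i))"
      unfolding N_def using that by (intro mult_ln_nn_integral_lsc)
    then have "enn2ereal (N x) \<le> enn2ereal (liminf (\<lambda>i. N (y i)))"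
      by (simp add: less_eq_ennreal.rep_eq)
    also have "\<dots> = liminf (\<lambda>i. enn2ereal (N (y i)))"
      by (rule Liminf_compose_continuous_mono[symmetric])
         (auto simp: continuous_on_enn2ereal mono_def less_eq_ennreal.rep_eq)
    finally have "ereal (J M x) + enn2ereal (N x) \<le> ereal (J M x) + liminf (\<lambda>i. enn2ereal (N (y i)))"
      by (rule add_left_mono)
    \<comment> \<open>The first summand converges to a real number, so the lower limit of the sum
      splits even where \<open>N\<close> is infinite.\<close>
    also have "\<dots> = liminf (\<lambda>i. ereal (J (Ms i) (y i)) + enn2ereal (N (y i)))"
      using J_lim[OF that(2,1,3)] by (intro ereal_liminf_lim_add[symmetric]) auto
    finally show ?thesis
      using that by (simp add: energy)
  qed
  moreover have "\<exists>y. (\<forall>i. y i \<in> densities \<mu> \<rho>\<^sub>0) \<and> weak_L1_conv \<mu> y x \<and>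
      limsup (\<lambda>i. onsager_energy \<mu> (Ms i) (y i)) = onsager_energy \<mu> M x" if x: "x \<in> densities \<mu> \<rho>\<^sub>0" for x
  proof (intro exI conjI allI)
    show conv: "weak_L1_conv \<mu> (\<lambda>_. x) x"
      by (simp add: weak_L1_conv_def)
    have "(\<lambda>i. ereal (J (Ms i) x) + enn2ereal (N x)) \<longlonglongrightarrow> ereal (J M x) + enn2ereal (N x)"
      \<comment> \<open>If the entropy of \<open>x\<close> is infinite, both sides are infinite; the
        sum of limits is defined because the \<open>J\<close> limit is real.\<close>
      using J_lim[OF x x conv] by (intro tendsto_add_ereal_general tendsto_const) auto
    then show "limsup (\<lambda>i. onsager_energy \<mu> (Ms i) x) = onsager_energy \<mu> M x"
      using x by (auto simp: energy intro: lim_imp_Limsup)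
  qed (rule x)
  moreover have "\<exists>r. strict_mono r \<and> (\<exists>x\<in>densities \<mu> \<rho>\<^sub>0. weak_L1_conv \<mu> (\<lambda>j. y (r j)) x)"
    if y: "\<And>i. y i \<in> densities \<mu> \<rho>\<^sub>0" and C: "\<And>i. \<bar>onsager_energy \<mu> (Ms i) (y i)\<bar> \<le> ereal C" for y C
  proof -
    \<comment> \<open>Dropping the nonnegative interaction from the energy bound leaves the entropy
      bound, enlarged by the total measure because of the shift by 1.\<close>
    have "N (y i) \<le> ennreal (C + measure \<mu> (space \<mu>))" for i
    proof -
      have "0 \<le> I (Ms i) (y i)"
        unfolding I_def by (rule interaction_nonneg[OF y])
      moreover have "\<bar>ereal (J (Ms i) (y i)) + enn2ereal (N (y i))\<bar> \<le> ereal C"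
        using C[of i] y by (simp add: energy)
      ultimately show ?thesis
        by (cases "N (y i)") (auto simp: J_def enn2ereal_ennreal simp del: ennreal_plus intro!: ennreal_leI)
    qed
    then have ui: "\<exists>d>0. \<forall>i. \<forall>A\<in>sets \<mu>. measure \<mu> A < d \<longrightarrow> (\<integral>R. y i R * indicator A R \<partial>\<mu>) \<le> e" if "e > 0" for e
      unfolding N_def by (rule mult_ln_bounded_uniformly_integrable[OF y _ that])
    have "SO \<in> sets borel"
      using compact_SO by (intro borel_closed compact_imp_closed)
    then obtain G where G: "countable G" "Int_stable G" "G \<subseteq> Pow (space \<mu>)" "sets \<mu> = sigma_sets (space \<mu>) G"
      unfolding space sets by (rule countable_Int_stable_generator_restrict_borel)
    obtain r g where "strict_mono r" "g \<in> densities \<mu> \<rho>\<^sub>0" "weak_L1_conv \<mu> (\<lambda>j. y (r j)) g"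
      by (rule weak_L1_sequentially_compact[OF G y ui])
    then show ?thesis by blast
  qed
  ultimately show ?thesis
    unfolding gamma_converges_def equicoercive_def by blast
qed

end
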